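(* Let $P$ be the true transition kernel of a discounted MDP with rewards $r(s,a)\in[0,R_{\max}]$ and discount factor $\gamma\in(0,1)$, and let $\mathscr M$ be a class of candidate transition kernels. Assume the standard regularity conditions listed in the context. Consider an online interaction over rounds $t=1,\dots,T$: in round $t$ an adversary chooses a policy $\pi_t$, then the model-player outputs a kernel $\hat P_t\in\mathscr M$ (possibly using past information) and incurs the loss $\ell_t(\hat P_t)=\mathcal L_{\pi_t}(\hat P_t)$. Suppose the model-player produces kernels $\hat P_1,\dots,\hat P_T\in\mathscr M$ and attains regret $$\mathrm{Regret}_T=\sum_{t=1}^T \ell_t(\hat P_t)-\min_{\hat P\in\mathscr M}\sum_{t=1}^T\ell_t(\hat P)$$ relative to the losses $\ell_t(\hat P)=\mathcal L_{\pi_t}(\hat P)$. Define the per-round value gap as $\Delta_t=|V_{\pi_t}(P)-V_{\pi_t}(\hat P_t)|$. Then $$\frac1T\sum_{t=1}^T\Delta_t\;\le\;\frac{\gamma R_{\max}}{(1-\gamma)^{3/2}}\sqrt{\frac12\left(\min_{\hat P\in\mathscr M}\frac1T\sum_{t=1}^T\mathcal L_{\pi_t}(\hat P)+\frac{\mathrm{Regret}_T}{T}\right)}.$$ In particular, if the model-player runs a no-regret algorithm with $\mathrm{Regret}_T=o(T)$, then the average value-gap $\frac1T\sum_{t=1}^T\Delta_t$ converges (as $T\to\infty$) to the intrinsic approximation term $$\frac{\gamma R_{\max}}{(1-\gamma)^{3/2}}\sqrt{\frac12\min_{\hat P\in\mathscr M}\frac1T\sum_{t=1}^T\mathcal L_{\pi_t}(\hat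 P)}.$$
   Context: An MDP has state space $\mathscr S$, action space $\mathscr A$, transition kernel $P(\cdot\mid s,a)$, known reward $r(s,a)\in[0,R_{\max}]$, discount $\gamma\in(0,1)$ and initial state law $\rho_0$; a policy $\pi$ is a (possibly randomized) stationary map from states to distributions on actions. For a kernel $Q$, $V_\pi(Q)$ is the expected discounted return $\mathbb E[\sum_{t\ge0}\gamma^t r(s_t,a_t)]$ of $\pi$ from $s_0\sim\rho_0$ when transitions follow $Q$. The unnormalized discounted occupancy of $\pi$ under the true kernel $P$ is $d_\pi(s,a)=\mathbb E[\sum_{t\ge 0}\gamma^t\mathbf 1\{(s_t,a_t)=(s,a)\}]$ (total mass $1/(1-\gamma)$), and $\mathbb E_{(s,a)\sim d_\pi}[f(s,a)]$ denotes $\sum_{s,a}d_\pi(s,a)f(s,a)$ (or the corresponding integral), with no normalization. The loss of a kernel $\hat P$ under $\pi$ is the expected negative log-likelihood $$\mathcal L_\pi(\hat P)=\mathbb E_{(s,a)\sim d_\pi}\big[\mathbb E_{s'\sim P(\cdot\mid s,a)}[-\log\hat P(s'\mid s,a)]\big]=\mathbb E_{d_\pi}[\mathrm{KL}(P\,\|\,\hat P)]+\mathbb E_{d_\pi}[H(P(\cdot\mid s,a))],$$ where $H$ is the entropy. Regularity conditions: the state and action spaces are finite (discrete), or Borel spaces admitting densities with respect to a fixed dominating measure; all kernels $\hat P(\cdot\mid s,a)$ under consideration are absolutely continuous with respect to $P(\cdot\mid s,a)$ (or, more generally, have almost-everywhere positive densities), so that $\mathrm{KL}(P(\cdot\mid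 s,a)\,\|\,\hat P(\cdot\mid s,a))$ is well defined (possibly $+\infty$) for every $(s,a)$. In the discrete case $H\ge 0$; for continuous spaces, where $H$ may be negative, one works with the expected KL $\mathbb E_{d_\pi}[\mathrm{KL}(P\,\|\,\hat P)]$ directly in place of $\mathcal L_\pi(\hat P)$.
   Formalization: The average value-gap need not converge to the intrinsic term (zero reward, positive loss); proved instead: under o(T) regret the upper bound minus the intrinsic term tends to 0, and limsup of the average value-gap minus the intrinsic term is at most 0. *)

theory Defs
  imports "HOL-Probability.Probability" "HOL-Library.Landau_Symbols"
begin

section \<open>Discounted Markov decision processes\<close>

text \<open>
  Of \<open>states\<close> and \<open>actions\<close> only the underlying measurable spaces matter.
\<close>

record ('s, 'a) mdp =
  states :: "'s measure"
  actions :: "'a measure"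
  transition :: "'s \<times> 'a \<Rightarrow> 's measure"
  reward :: "'s \<times> 'a \<Rightarrow> real"
  discount :: real
  initial :: "'s measure"

abbreviation state_actions :: "('s, 'a) mdp \<Rightarrow> ('s \<times> 'a) measure" where
  "state_actions M \<equiv> states M \<Otimes>\<^sub>M actions M"

definition transition_kernels :: "('s, 'a) mdp \<Rightarrow> ('s \<times> 'a \<Rightarrow> 's measure) set" where
  "transition_kernels M = state_actions M \<rightarrow>\<^sub>M prob_algebra (states M)"

definition policies :: "('s, 'a) mdp \<Rightarrow> ('s \<Rightarrow> 'a measure) set" where
  "policies M = states M \<rightarrow>\<^sub>M prob_algebra (actions M)"

definition discounted_mdp :: "('s, 'a) mdp \<Rightarrow> real \<Rightarrow> bool" where
  "discounted_mdp M Rmax \<longleftrightarrow>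
     transition M \<in> transition_kernels M \<and>
     reward M \<in> borel_measurable (state_actions M) \<and>
     (\<forall>x \<in> space (state_actions M). 0 \<le> reward M x \<and> reward M x \<le> Rmax) \<and>
     0 < discount M \<and> discount M < 1 \<and>
     initial M \<in> space (prob_algebra (states M))"

section \<open>Trajectories, value and occupancy\<close>

definition choose_action ::
    "('s, 'a) mdp \<Rightarrow> ('s \<Rightarrow> 'a measure) \<Rightarrow> 's measure \<Rightarrow> ('s \<times> 'a) measure" where
  "choose_action M \<pi> \<mu> = \<mu> \<bind> (\<lambda>s. \<pi> s \<bind> (\<lambda>a. return (state_actions M) (s, a)))"

text \<open>
  The conditional law of the \<open>n\<close>-th state-action pair given the pairs with index below \<open>n\<close>,
  when transitions follow the kernel \<open>Q\<close>.
\<close>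

fun step_law ::
    "('s, 'a) mdp \<Rightarrow> ('s \<times> 'a \<Rightarrow> 's measure) \<Rightarrow> ('s \<Rightarrow> 'a measure) \<Rightarrow>
     nat \<Rightarrow> (nat \<Rightarrow> 's \<times> 'a) \<Rightarrow> ('s \<times> 'a) measure" where
  "step_law M Q \<pi> 0 \<omega> = choose_action M \<pi> (initial M)"
| "step_law M Q \<pi> (Suc n) \<omega> = choose_action M \<pi> (Q (\<omega> n))"

text \<open>
  The law of the whole trajectory \<open>(s\<^sub>0, a\<^sub>0), (s\<^sub>1, a\<^sub>1), \<dots>\<close> is the projective limit that
  the Ionescu-Tulcea theorem provides for these conditional laws.
\<close>

definition trajectory ::
    "('s, 'a) mdp \<Rightarrow> ('s \<times> 'a \<Rightarrow> 's measure) \<Rightarrow> ('s \<Rightarrow> 'a measure) \<Rightarrow>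
     (nat \<Rightarrow> 's \<times> 'a) measure" where
  "trajectory M Q \<pi> =
     projective_family.lim UNIV
       (Ionescu_Tulcea.CI (step_law M Q \<pi>) (\<lambda>_. state_actions M)) (\<lambda>_. state_actions M)"

definition policy_value ::
    "('s, 'a) mdp \<Rightarrow> ('s \<Rightarrow> 'a measure) \<Rightarrow> ('s \<times> 'a \<Rightarrow> 's measure) \<Rightarrow> real" where
  "policy_value M \<pi> Q =
     (\<integral>\<omega>. (\<Sum>t. discount M ^ t * reward M (\<omega> t)) \<partial>trajectory M Q \<pi>)"

text \<open>The occupancy is not normalized: its total mass is \<open>1 / (1 - discount M)\<close>.\<close>

definition occupancy ::
    "('s, 'a) mdp \<Rightarrow> ('s \<Rightarrow> 'a measure) \<Rightarrow> ('s \<times> 'a) measure" where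
  "occupancy M \<pi> =
     measure_of (space (state_actions M)) (sets (state_actions M))
       (\<lambda>B. \<integral>\<^sup>+\<omega>. (\<Sum>t. ennreal (discount M ^ t) * indicator B (\<omega> t))
              \<partial>trajectory M (transition M) \<pi>)"

definition value_gap ::
    "('s, 'a) mdp \<Rightarrow> ('s \<Rightarrow> 'a measure) \<Rightarrow> ('s \<times> 'a \<Rightarrow> 's measure) \<Rightarrow> real" where
  "value_gap M \<pi> Q = \<bar>policy_value M \<pi> (transition M) - policy_value M \<pi> Q\<bar>"

section \<open>Losses\<close>

text \<open>
  \<open>neg_log\<close> is only applied to probabilities, for which \<open>- ln p\<close> is nonnegative.
\<close>

definition neg_log :: "real \<Rightarrow> ennreal" where
  "neg_log p = (if p = 0 then \<infinity> else ennreal (- ln p))"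

text \<open>The expected negative log-likelihood, for discrete state spaces.\<close>

definition nll_loss ::
    "('s, 'a) mdp \<Rightarrow> ('s \<Rightarrow> 'a measure) \<Rightarrow> ('s \<times> 'a \<Rightarrow> 's measure) \<Rightarrow> ereal" where
  "nll_loss M \<pi> Q =
     enn2ereal (\<integral>\<^sup>+x. (\<integral>\<^sup>+s'. neg_log (measure (Q x) {s'}) \<partial>transition M x) \<partial>occupancy M \<pi>)"

text \<open>
  \<open>KL \<mu> \<nu>\<close> is the divergence of \<open>\<mu>\<close> from \<open>\<nu>\<close>, in nats. The library's \<open>KL_divergence\<close> takes the
  reference measure first and is real-valued, with a meaningless value when the divergence is
  infinite. The negative part of the log-density ratio is always \<open>\<mu>\<close>-integrable, so that
  non-integrability means an infinite divergence.
\<close>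

definition KL :: "'b measure \<Rightarrow> 'b measure \<Rightarrow> ennreal" where
  "KL \<mu> \<nu> =
     (if absolutely_continuous \<nu> \<mu> \<and> integrable \<mu> (entropy_density (exp 1) \<nu> \<mu>)
      then ennreal (KL_divergence (exp 1) \<nu> \<mu>) else \<infinity>)"

definition kl_loss ::
    "('s, 'a) mdp \<Rightarrow> ('s \<Rightarrow> 'a measure) \<Rightarrow> ('s \<times> 'a \<Rightarrow> 's measure) \<Rightarrow> ereal" where
  "kl_loss M \<pi> Q = enn2ereal (\<integral>\<^sup>+x. KL (transition M x) (Q x) \<partial>occupancy M \<pi>)"

section \<open>Regularity of the model class\<close>

definition kernel_density ::
    "('s, 'a) mdp \<Rightarrow> 's measure \<Rightarrow> ('s \<times> 'a \<Rightarrow> 's measure) \<Rightarrow>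
     (('s \<times> 'a) \<times> 's \<Rightarrow> ennreal) \<Rightarrow> bool" where
  "kernel_density M \<nu> Q q \<longleftrightarrow>
     q \<in> borel_measurable (state_actions M \<Otimes>\<^sub>M \<nu>) \<and>
     (\<forall>x \<in> space (state_actions M). Q x = density \<nu> (\<lambda>s'. q (x, s')))"

text \<open>
  \<open>absolutely_continuous (transition M x) (Q x)\<close> says that \<open>Q x\<close> is absolutely continuous with
  respect to \<open>transition M x\<close>.
\<close>

definition regular_class ::
    "('s, 'a) mdp \<Rightarrow> 's measure \<Rightarrow> ('s \<times> 'a \<Rightarrow> 's measure) set \<Rightarrow> bool" where
  "regular_class M \<nu> \<M> \<longleftrightarrow>
     \<M> \<subseteq> transition_kernels M \<and>
     (\<exists>p. kernel_density M \<nu> (transition M) p) \<and>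
     (\<forall>Q \<in> \<M>. \<exists>q. kernel_density M \<nu> Q q \<and>
        (\<forall>x \<in> space (state_actions M).
           absolutely_continuous (transition M x) (Q x) \<or> (AE s' in \<nu>. 0 < q (x, s'))))"

definition finite_regular :: "('s, 'a) mdp \<Rightarrow> ('s \<times> 'a \<Rightarrow> 's measure) set \<Rightarrow> bool" where
  "finite_regular M \<M> \<longleftrightarrow>
     finite (space (states M)) \<and> sets (states M) = Pow (space (states M)) \<and>
     finite (space (actions M)) \<and> sets (actions M) = Pow (space (actions M)) \<and>
     regular_class M (count_space (space (states M))) \<M>"

definition density_regular :: "('s, 'a) mdp \<Rightarrow> ('s \<times> 'a \<Rightarrow> 's measure) set \<Rightarrow> bool" where
  "density_regular M \<M> \<longleftrightarrow>
     (\<exists>\<nu>. sigma_finite_measure \<nu> \<and> sets \<nu> = sets (states M) \<and> regular_class M \<nu> \<M>)"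

section \<open>Online interaction\<close>

text \<open>
  Below, \<open>\<pi> t\<close> and \<open>Q t\<close> are the policy and the kernel of round \<open>t\<close>, and rounds are numbered
  from 1. Minima over the model class are rendered as infima in \<open>ereal\<close>; in that type
  \<open>\<infinity> - \<infinity> = \<infinity>\<close>.
\<close>

definition regret ::
    "('p \<Rightarrow> 'k \<Rightarrow> ereal) \<Rightarrow> 'k set \<Rightarrow> (nat \<Rightarrow> 'p) \<Rightarrow> (nat \<Rightarrow> 'k) \<Rightarrow> nat \<Rightarrow> ereal" where
  "regret loss \<M> \<pi> Q T =
     (\<Sum>t = 1..T. loss (\<pi> t) (Q t)) - (INF K \<in> \<M>. \<Sum>t = 1..T. loss (\<pi> t) K)"

definition best_average_loss ::
    "('p \<Rightarrow> 'k \<Rightarrow> ereal) \<Rightarrow> 'k set \<Rightarrow> (nat \<Rightarrow> 'p) \<Rightarrow> nat \<Rightarrow> ereal" where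
  "best_average_loss loss \<M> \<pi> T =
     (INF K \<in> \<M>. (\<Sum>t = 1..T. loss (\<pi> t) K) / ereal (real T))"

definition average_gap ::
    "('s, 'a) mdp \<Rightarrow> (nat \<Rightarrow> 's \<Rightarrow> 'a measure) \<Rightarrow> (nat \<Rightarrow> 's \<times> 'a \<Rightarrow> 's measure) \<Rightarrow>
     nat \<Rightarrow> real" where
  "average_gap M \<pi> Q T = (\<Sum>t = 1..T. value_gap M (\<pi> t) (Q t)) / real T"

text \<open>Only meant for nonnegative arguments.\<close>

definition ereal_sqrt :: "ereal \<Rightarrow> ereal" where
  "ereal_sqrt x = (if x = \<infinity> then \<infinity> else ereal (sqrt (real_of_ereal x)))"

text \<open>
  The right-hand side of the value-gap bound for average loss \<open>l\<close>. With \<open>l\<close> the best average loss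
  in the class it is the intrinsic approximation term.
\<close>

definition gap_bound :: "('s, 'a) mdp \<Rightarrow> real \<Rightarrow> ereal \<Rightarrow> ereal" where
  "gap_bound M Rmax l =
     ereal (discount M * Rmax / (1 - discount M) powr (3 / 2)) * ereal_sqrt (ereal (1 / 2) * l)"

end

theory Submission
  imports Defs "HOL-Probability.Hoeffding"
begin

text \<open>
  Write the reward as \<open>w - \<gamma> (Q w)\<close>, where \<open>w\<close> is the action value of the policy under the model
  \<open>Q\<close>. Its expected discounted sum along trajectories of the true kernel \<open>P\<close> telescopes, so the
  difference of the two values is \<open>\<gamma>\<close> times the integral, against the occupancy, of the difference
  of the means of the state value under \<open>P\<close> and under \<open>Q\<close>. That state value has range
  \<open>[0, Rmax / (1 - \<gamma>)]\<close>, so Pinsker's inequality bounds the square of the difference of means by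
  \<open>(Rmax / (1 - \<gamma>))\<^sup>2 / 2\<close> times the divergence, and hence times the negative log-likelihood in the
  discrete case. Cauchy--Schwarz, first over the occupancy (of mass \<open>1 / (1 - \<gamma>)\<close>) and then over
  the rounds, gives the bound. The asymptotic claim is
  \<open>\<bar>sqrt x - sqrt y\<bar> \<le> sqrt \<bar>x - y\<bar>\<close>, applied to the losses of the player and of the best model.
\<close>

section \<open>Pinsker's inequality for bounded functions\<close>

text \<open>
  The Donsker--Varadhan inequality, combined with Hoeffding's lemma for the moment generating
  function of \<open>f\<close> under \<open>N\<close> and optimized over the exponent \<open>l\<close>.
\<close>

lemma mean_difference_le_of_exp_dominated:
  fixes f u :: "'b \<Rightarrow> real"
  assumes "prob_space P" "prob_space N" and sets_eq: "sets N = sets P"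
    and f: "f \<in> borel_measurable P" and bnd: "\<And>x. x \<in> space P \<Longrightarrow> f x \<in> {a..b}"
    and u: "integrable P u"
    and dom: "\<And>g. g \<in> borel_measurable P \<Longrightarrow>
      (\<integral>\<^sup>+x. g x * ennreal (exp (- u x)) \<partial>P) \<le> (\<integral>\<^sup>+x. g x \<partial>N)"
    and pos: "integral\<^sup>L P f > integral\<^sup>L N f"
  shows "(integral\<^sup>L P f - integral\<^sup>L N f)\<^sup>2 \<le> (b - a)\<^sup>2 / 2 * integral\<^sup>L P u"
proof -
  interpret P: prob_space P by fact
  interpret N: prob_space N by fact
  have sp: "space N = space P" using sets_eq by (rule sets_eq_imp_space_eq)
  have fN: "f \<in> borel_measurable N" using f sets_eq by (simp cong: measurable_cong_sets)
  interpret HP: interval_bounded_random_variable P f a b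
    by unfold_locales (use f bnd in auto)
  interpret HN: interval_bounded_random_variable N f a b
    by unfold_locales (use fN bnd sp in auto)
  define \<nu> where "\<nu> = integral\<^sup>L N f"
  define \<Delta> where "\<Delta> = integral\<^sup>L P f - \<nu>"
  have \<Delta>: "\<Delta> > 0" using pos by (simp add: \<Delta>_def \<nu>_def)
  \<comment> \<open>The mean under \<open>P\<close> is at most \<open>b\<close> and the mean under
    \<open>N\<close> at least \<open>a\<close>, so a strict gap gives \<open>a < b\<close>. The
    exponent \<open>l\<close> divides by this width.\<close>
  have "integral\<^sup>L P f \<le> b" "a \<le> integral\<^sup>L N f"
    using P.integral_le_const[OF HP.integrable, of b] N.integral_ge_const[OF HN.integrable, of a]
      HP.AE_in_interval HN.AE_in_interval by auto
  then have ab: "a < b" using pos by simp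
  \<comment> \<open>This exponent maximizes
    \<open>l * \<Delta> - l\<^sup>2 * (b - a)\<^sup>2 / 8\<close>, whose second term is the
    Hoeffding bound \<open>c\<close>. The maximum is
    \<open>2 * \<Delta>\<^sup>2 / (b - a)\<^sup>2\<close>.\<close>
  define l where "l = 4 * \<Delta> / (b - a)\<^sup>2"
  have l: "l > 0" using \<Delta> ab by (simp add: l_def)
  define c where "c = l\<^sup>2 * (b - a)\<^sup>2 / 8"
  \<comment> \<open>The factor \<open>exp (- u x)\<close> lets \<open>dom\<close> pass from
    \<open>P\<close> to \<open>N\<close>, where Hoeffding's lemma applies. The factor
    \<open>exp (- c)\<close> then normalizes, so that \<open>v\<close> has \<open>P\<close>-integral
    at most 1.\<close>
  define v where "v x = exp (l * (f x - \<nu>) - u x - c)" for x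
  note [measurable] = f borel_measurable_integrable[OF u]
  have "(\<integral>\<^sup>+x. ennreal (v x) \<partial>P)
      = (\<integral>\<^sup>+x. ennreal (exp (l * (f x - \<nu>) - c)) * ennreal (exp (- u x)) \<partial>P)"
    by (intro nn_integral_cong) (simp add: v_def ennreal_mult[symmetric] exp_add[symmetric])
  also have "\<dots> \<le> (\<integral>\<^sup>+x. ennreal (exp (l * (f x - \<nu>) - c)) \<partial>N)"
    by (rule dom) measurable
  also have "\<dots> = (\<integral>\<^sup>+x. ennreal (exp (- c)) * ennreal (exp (l * (f x - \<nu>))) \<partial>N)"
    by (intro nn_integral_cong) (simp add: ennreal_mult[symmetric] exp_add[symmetric])
  also have "\<dots> = ennreal (exp (- c)) * (\<integral>\<^sup>+x. ennreal (exp (l * (f x - \<nu>))) \<partial>N)"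
    using fN by (intro nn_integral_cmult) measurable
  also have "\<dots> \<le> ennreal (exp (- c)) * ennreal (exp c)"
    using HN.Hoeffdings_lemma_nn_integral[OF l] by (intro mult_left_mono) (auto simp: c_def \<nu>_def)
  also have "\<dots> = 1" by (simp add: ennreal_mult[symmetric] exp_add[symmetric])
  finally have v1: "(\<integral>\<^sup>+x. ennreal (v x) \<partial>P) \<le> 1" .
  have vm: "v \<in> borel_measurable P" unfolding v_def by measurable
  have vint: "integrable P v"
    using v1 by (intro integrableI_nonneg vm) (auto simp: v_def top_unique intro: le_less_trans)
  have "ennreal (integral\<^sup>L P v) \<le> 1"
    using v1 by (subst nn_integral_eq_integral[symmetric, OF vint]) (auto simp: v_def)
  then have v2: "integral\<^sup>L P v \<le> 1" by simp
  \<comment> \<open>Integrating \<open>1 + y \<le> exp y\<close> stands in for Jensen's inequality: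
    since \<open>exp y\<close> has integral at most 1, the exponent has integral at most 0.\<close>
  have "integral\<^sup>L P (\<lambda>x. 1 + (l * (f x - \<nu>) - u x - c)) \<le> integral\<^sup>L P v"
    using u HP.integrable vint by (intro integral_mono) (auto simp: v_def)
  moreover have "integral\<^sup>L P (\<lambda>x. 1 + (l * (f x - \<nu>) - u x - c)) = 1 + l * \<Delta> - integral\<^sup>L P u - c"
    using u HP.integrable by (simp add: \<Delta>_def P.prob_space algebra_simps)
  ultimately have "l * \<Delta> - c \<le> integral\<^sup>L P u" using v2 by linarith
  moreover have "l * \<Delta> - c = 2 * \<Delta>\<^sup>2 / (b - a)\<^sup>2"
  proof -
    have "w > 0 \<Longrightarrow> 4 * \<Delta> / w\<^sup>2 * \<Delta> - (4 * \<Delta> / w\<^sup>2)\<^sup>2 * w\<^sup>2 / 8 = 2 * \<Delta>\<^sup>2 / w\<^sup>2" for w :: real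
      by (simp add: field_simps power2_eq_square)
    from this[of "b - a"] show ?thesis using ab by (simp add: l_def c_def)
  qed
  ultimately have "2 * \<Delta>\<^sup>2 / (b - a)\<^sup>2 \<le> integral\<^sup>L P u" by simp
  then show ?thesis using ab by (simp add: \<Delta>_def \<nu>_def field_simps)
qed

text \<open>The one-sided estimate applies to \<open>f\<close> or to \<open>- f\<close>, whose range
  is \<open>{- L..0}\<close>, according to the sign of the difference. The hypothesis
  \<open>dom\<close> expresses that \<open>exp (- u)\<close> times \<open>P\<close> is dominated by
  \<open>N\<close>. Both the log-density ratio and the negative log-probability under
  \<open>N\<close> satisfy it, so one lemma serves both losses.\<close>

lemma mean_difference_square_le:
  fixes f u :: "'b \<Rightarrow> real"
  assumes P: "prob_space P" and N: "prob_space N" and sets_eq: "sets N = sets P"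
    and f: "f \<in> borel_measurable P" and bnd: "\<And>x. x \<in> space P \<Longrightarrow> f x \<in> {0..L}"
    and u: "integrable P u" "0 \<le> integral\<^sup>L P u"
    and dom: "\<And>g. g \<in> borel_measurable P \<Longrightarrow>
      (\<integral>\<^sup>+x. g x * ennreal (exp (- u x)) \<partial>P) \<le> (\<integral>\<^sup>+x. g x \<partial>N)"
  shows "(integral\<^sup>L P f - integral\<^sup>L N f)\<^sup>2 \<le> L\<^sup>2 / 2 * integral\<^sup>L P u"
proof (cases "integral\<^sup>L P f" "integral\<^sup>L N f" rule: linorder_cases)
  case greater
  from mean_difference_le_of_exp_dominated[OF P N sets_eq f bnd u(1) dom greater]
  show ?thesis by simp
next
  case equal
  then show ?thesis using u by simp
next
  case less
  have "(integral\<^sup>L P (\<lambda>x. - f x) - integral\<^sup>L N (\<lambda>x. - f x))\<^sup>2 \<le> (0 - (- L))\<^sup>2 / 2 * integral\<^sup>L P u"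
    by (rule mean_difference_le_of_exp_dominated[OF P N sets_eq _ _ u(1) dom])
      (use f bnd less in auto)
  then show ?thesis by (simp add: power2_commute)
qed

text \<open>Integrating \<open>1 - u \<le> exp (- u)\<close> gives
  \<open>1 - integral\<^sup>L P u \<le> 1\<close>. For \<open>u\<close> the log-density ratio this
  is Gibbs' inequality; it guarantees that \<open>ennreal\<close> in \<open>KL\<close> truncates
  nothing.\<close>

lemma integral_nonneg_of_exp_dominated:
  fixes u :: "'b \<Rightarrow> real"
  assumes "prob_space P" "prob_space N" and u: "integrable P u"
    and dom: "(\<integral>\<^sup>+x. ennreal (exp (- u x)) \<partial>P) \<le> (\<integral>\<^sup>+x. 1 \<partial>N)"
  shows "0 \<le> integral\<^sup>L P u"
proof -
  interpret P: prob_space P by fact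
  interpret N: prob_space N by fact
  note [measurable] = borel_measurable_integrable[OF u]
  have 1: "(\<integral>\<^sup>+x. ennreal (exp (- u x)) \<partial>P) \<le> 1"
    using dom by (simp add: N.emeasure_space_1)
  have i: "integrable P (\<lambda>x. exp (- u x))"
    using 1 by (intro integrableI_nonneg) (auto simp: top_unique intro: le_less_trans)
  have "ennreal (\<integral>x. exp (- u x) \<partial>P) \<le> 1"
    using 1 by (subst nn_integral_eq_integral[symmetric, OF i]) auto
  then have "(\<integral>x. exp (- u x) \<partial>P) \<le> 1" by simp
  moreover have "(\<integral>x. 1 + (- u x) \<partial>P) \<le> (\<integral>x. exp (- u x) \<partial>P)"
    using u i by (intro integral_mono) (auto intro: exp_ge_add_one_self[of "- u _", simplified])
  ultimately show ?thesis using u by (simp add: P.prob_space)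
qed

text \<open>Take \<open>u\<close> to be the log of the density \<open>h\<close> of \<open>P\<close>
  with respect to \<open>N\<close>. Then \<open>h * exp (- u)\<close> is 1 where \<open>h\<close> is
  positive and finite and 0 where \<open>h\<close> vanishes, so \<open>exp (- u)\<close> times
  \<open>P\<close> is dominated by \<open>N\<close>, possibly strictly.\<close>

lemma mean_difference_square_le_KL:
  fixes f :: "'b \<Rightarrow> real"
  assumes P: "prob_space P" and N: "prob_space N" and sets_eq: "sets N = sets P"
    and f: "f \<in> borel_measurable P" and bnd: "\<And>x. x \<in> space P \<Longrightarrow> f x \<in> {0..L}"
  shows "ennreal ((integral\<^sup>L P f - integral\<^sup>L N f)\<^sup>2) \<le> ennreal (L\<^sup>2 / 2) * KL P N"
proof (cases "absolutely_continuous N P \<and> integrable P (entropy_density (exp 1) N P)")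
  case True
  interpret P: prob_space P by fact
  interpret N: prob_space N by fact
  define h where "h = RN_deriv N P"
  define u where "u = entropy_density (exp 1) N P"
  have u: "integrable P u" using True by (simp add: u_def)
  have dens: "density N h = P"
    unfolding h_def using True sets_eq by (intro N.density_RN_deriv) auto
  \<comment> \<open>At an infinite density \<open>enn2real\<close> would return 0, and
    \<open>exp (- u x)\<close> would no longer be the reciprocal of \<open>h x\<close>.\<close>
  have fin: "AE x in N. h x \<noteq> \<infinity>"
    unfolding h_def using True sets_eq by (intro N.RN_deriv_finite) (auto intro: P.sigma_finite_measure)
  have [measurable]: "h \<in> borel_measurable N" by (simp add: h_def)
  have ux: "u x = ln (enn2real (h x))" for x
    by (simp add: u_def entropy_density_def h_def log_def)
  have dom: "(\<integral>\<^sup>+x. g x * ennreal (exp (- u x)) \<partial>P) \<le> (\<integral>\<^sup>+x. g x \<partial>N)"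
    if "g \<in> borel_measurable P" for g
  proof -
    have [measurable]: "g \<in> borel_measurable N"
      using that sets_eq by (simp cong: measurable_cong_sets)
    have "(\<integral>\<^sup>+x. g x * ennreal (exp (- u x)) \<partial>P)
        = (\<integral>\<^sup>+x. h x * (g x * ennreal (exp (- u x))) \<partial>N)"
      unfolding ux by (subst dens[symmetric], subst nn_integral_density) auto
    also have "\<dots> \<le> (\<integral>\<^sup>+x. g x \<partial>N)"
    proof (rule nn_integral_mono_AE)
      show "AE x in N. h x * (g x * ennreal (exp (- u x))) \<le> g x"
        using fin
      proof eventually_elim
        case (elim x)
        show ?case
        proof (cases "h x = 0")
          case False
          then obtain p where p: "h x = ennreal p" "p > 0"
            using elim by (cases "h x") (auto simp: ennreal_eq_0_iff not_le)
          have "h x * ennreal (exp (- u x)) = 1"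
            using p by (simp add: ux exp_minus ennreal_mult[symmetric])
          then show ?thesis by (metis mult.commute mult.left_commute mult_1 order_refl)
        qed simp
      qed
    qed
    finally show ?thesis .
  qed
  have nn: "0 \<le> integral\<^sup>L P u"
    using dom[of "\<lambda>_. 1"] by (intro integral_nonneg_of_exp_dominated[OF P N u]) auto
  have "(integral\<^sup>L P f - integral\<^sup>L N f)\<^sup>2 \<le> L\<^sup>2 / 2 * integral\<^sup>L P u"
    by (rule mean_difference_square_le[OF P N sets_eq f bnd u nn dom])
  moreover have "KL P N = ennreal (integral\<^sup>L P u)"
    using True by (simp add: KL_def KL_divergence_def u_def)
  ultimately show ?thesis
    using nn by (simp add: ennreal_mult[symmetric] ennreal_leI)
next
  case False
  show ?thesis
  \<comment> \<open>An infinite divergence makes the claim trivial only for a nonzero factor,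
    because \<open>0 * \<infinity> = 0\<close> in \<open>ennreal\<close>. For \<open>L = 0\<close>
    the function \<open>f\<close> itself vanishes.\<close>
  proof (cases "L = 0")
    case True
    interpret P: prob_space P by fact
    have "integral\<^sup>L P f = 0" "integral\<^sup>L N f = 0"
      using bnd True sets_eq_imp_space_eq[OF sets_eq] by (auto intro!: integral_eq_zero_AE)
    then show ?thesis by simp
  next
    case L: False
    then have "KL P N = \<infinity>" "ennreal (L\<^sup>2 / 2) \<noteq> 0"
      using False by (auto simp: KL_def)
    then show ?thesis by (simp add: ennreal_mult_top)
  qed
qed

section \<open>Negative log-likelihood on a finite space\<close>

lemma nn_integral_finite_Pow:
  assumes "finite (space P)" "sets P = Pow (space P)"
  shows "integral\<^sup>N P g = (\<Sum>s\<in>space P. emeasure P {s} * g s)"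
proof -
  have "P = density (count_space (space P)) (\<lambda>s. emeasure P {s})"
    using assms by (intro measure_eqI_finite[where A="space P"])
      (auto simp: emeasure_density nn_integral_count_space_finite)
  then have "integral\<^sup>N P g = integral\<^sup>N (density (count_space (space P)) (\<lambda>s. emeasure P {s})) g"
    by simp
  also have "\<dots> = (\<Sum>s\<in>space P. emeasure P {s} * g s)"
    using assms by (subst nn_integral_density) (auto simp: nn_integral_count_space_finite)
  finally show ?thesis .
qed

text \<open>With \<open>u s = - ln (measure N {s})\<close> the domination hypothesis reads pointwise
  \<open>P {s} * N {s} \<le> N {s}\<close>, which holds because \<open>P {s} \<le> 1\<close>. This
  takes the place of splitting the loss into divergence plus nonnegative entropy.\<close>

lemma mean_difference_square_le_nll:
  fixes f :: "'b \<Rightarrow> real"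
  assumes P: "prob_space P" and N: "prob_space N" and sets_eq: "sets N = sets P"
    and fin: "finite (space P)" "sets P = Pow (space P)"
    and f: "f \<in> borel_measurable P" and bnd: "\<And>x. x \<in> space P \<Longrightarrow> f x \<in> {0..L}"
  shows "ennreal ((integral\<^sup>L P f - integral\<^sup>L N f)\<^sup>2)
    \<le> ennreal (L\<^sup>2 / 2) * (\<integral>\<^sup>+s. neg_log (measure N {s}) \<partial>P)"
proof (cases "(\<integral>\<^sup>+s. neg_log (measure N {s}) \<partial>P) = \<infinity>")
  case False
  interpret P: prob_space P by fact
  interpret N: prob_space N by fact
  have sp: "space N = space P" using sets_eq by (rule sets_eq_imp_space_eq)
  \<comment> \<open>Where \<open>N\<close> has no mass, \<open>ln 0 = 0\<close> makes
    \<open>u\<close> zero while \<open>neg_log\<close> is infinite. The two agree only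
    \<open>P\<close>-almost everywhere, through \<open>ac\<close>.\<close>
  define u where "u s = - ln (measure N {s})" for s
  have bm: "g \<in> borel_measurable P" for g :: "'b \<Rightarrow> 'c::topological_space"
    using fin by (simp add: measurable_def)
  have u0: "0 \<le> u s" for s
    by (cases "measure N {s} = 0") (auto simp: u_def ln_le_zero_iff measure_nonneg zero_less_measure_iff)
  \<comment> \<open>A point of positive \<open>P\<close>-mass and zero \<open>N\<close>-mass would
    contribute an infinite term to the integral, which is finite in this case.\<close>
  have ac: "emeasure P {s} = 0" if "s \<in> space P" "measure N {s} = 0" for s
    using False that fin by (auto simp: nn_integral_finite_Pow[OF fin] neg_log_def ennreal_mult_eq_top_iff)
  have AE: "AE s in P. measure N {s} \<noteq> 0"
  proof (rule AE_I)
    show "{s \<in> space P. \<not> measure N {s} \<noteq> 0} \<subseteq> {s \<in> space P. measure N {s} = 0}" by auto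
    show "{s \<in> space P. measure N {s} = 0} \<in> sets P" using fin by auto
    then show "emeasure P {s \<in> space P. measure N {s} = 0} = 0"
      using ac fin by (subst emeasure_eq_sum_singleton) auto
  qed
  have eq: "(\<integral>\<^sup>+s. neg_log (measure N {s}) \<partial>P) = (\<integral>\<^sup>+s. ennreal (u s) \<partial>P)"
    by (rule nn_integral_cong_AE) (use AE in \<open>eventually_elim, auto simp: neg_log_def u_def\<close>)
  have u: "integrable P u"
    using False eq u0 by (intro integrableI_nonneg bm) (auto simp: less_top)
  have dom: "(\<integral>\<^sup>+x. g x * ennreal (exp (- u x)) \<partial>P) \<le> (\<integral>\<^sup>+x. g x \<partial>N)" for g
  proof -
    have "emeasure P {s} * (g s * ennreal (exp (- u s))) \<le> emeasure N {s} * g s" if "s \<in> space P" for s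
    proof (cases "measure N {s} = 0")
      case True
      then show ?thesis using ac that by simp
    next
      case False
      then have "ennreal (exp (- u s)) = emeasure N {s}"
        by (simp add: u_def N.emeasure_eq_measure zero_less_measure_iff)
      moreover have "emeasure P {s} \<le> 1" by (rule P.emeasure_le_1)
      ultimately show ?thesis
        by (metis mult.commute mult_1 mult_right_mono zero_le)
    qed
    then show ?thesis
      using fin sp sets_eq by (simp add: nn_integral_finite_Pow sum_mono)
  qed
  have "(integral\<^sup>L P f - integral\<^sup>L N f)\<^sup>2 \<le> L\<^sup>2 / 2 * integral\<^sup>L P u"
    using u0 by (intro mean_difference_square_le[OF P N sets_eq f bnd u _ dom]) auto
  then show ?thesis
    using u u0 by (simp add: eq nn_integral_eq_integral ennreal_mult[symmetric] ennreal_leI)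
next
  case True
  show ?thesis
  proof (cases "L = 0")
    case L: True
    have "integral\<^sup>L P f = 0" "integral\<^sup>L N f = 0"
      using bnd L sets_eq_imp_space_eq[OF sets_eq] by (auto intro!: integral_eq_zero_AE)
    then show ?thesis by simp
  next
    case L: False
    then have "ennreal (L\<^sup>2 / 2) \<noteq> 0" by simp
    then show ?thesis by (simp add: True ennreal_mult_top)
  qed
qed

section \<open>Trajectories as Markov chains\<close>

lemma measurable_choose_action:
  assumes \<pi>: "\<pi> \<in> policies M"
  shows "choose_action M \<pi> \<in> prob_algebra (states M) \<rightarrow>\<^sub>M prob_algebra (state_actions M)"
proof -
  have [measurable]: "\<pi> \<in> states M \<rightarrow>\<^sub>M prob_algebra (actions M)"
    using \<pi> by (simp add: policies_def)
  have [measurable]: "(\<lambda>s. \<pi> s \<bind> (\<lambda>a. return (state_actions M) (s, a)))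
      \<in> states M \<rightarrow>\<^sub>M prob_algebra (state_actions M)"
    by measurable
  have "(\<lambda>\<mu>. \<mu> \<bind> (\<lambda>s. \<pi> s \<bind> (\<lambda>a. return (state_actions M) (s, a))))
      \<in> prob_algebra (states M) \<rightarrow>\<^sub>M prob_algebra (state_actions M)"
    by (rule measurable_bind_prob_space[where N="states M"]) auto
  then show ?thesis by (simp add: choose_action_def[abs_def])
qed

lemma nn_integral_choose_action:
  assumes \<pi>: "\<pi> \<in> policies M" and \<mu>: "\<mu> \<in> space (prob_algebra (states M))"
    and f[measurable]: "f \<in> borel_measurable (state_actions M)"
  shows "(\<integral>\<^sup>+x. f x \<partial>choose_action M \<pi> \<mu>) = (\<integral>\<^sup>+s. (\<integral>\<^sup>+a. f (s, a) \<partial>\<pi> s) \<partial>\<mu>)"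
proof -
  have \<pi>m[measurable]: "\<pi> \<in> states M \<rightarrow>\<^sub>M prob_algebra (actions M)"
    using \<pi> by (simp add: policies_def)
  have sets: "sets \<mu> = sets (states M)" using \<mu> by (simp add: space_prob_algebra)
  have k[measurable]: "(\<lambda>s. \<pi> s \<bind> (\<lambda>a. return (state_actions M) (s, a)))
      \<in> states M \<rightarrow>\<^sub>M prob_algebra (state_actions M)"
    by measurable
  have "(\<integral>\<^sup>+x. f x \<partial>choose_action M \<pi> \<mu>)
      = (\<integral>\<^sup>+s. (\<integral>\<^sup>+x. f x \<partial>(\<pi> s \<bind> (\<lambda>a. return (state_actions M) (s, a)))) \<partial>\<mu>)"
    unfolding choose_action_def using measurable_prob_algebraD[OF k] sets
    by (intro nn_integral_bind[OF f]) (simp cong: measurable_cong_sets)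
  also have "\<dots> = (\<integral>\<^sup>+s. (\<integral>\<^sup>+a. f (s, a) \<partial>\<pi> s) \<partial>\<mu>)"
  proof (rule nn_integral_cong)
    fix s assume "s \<in> space \<mu>"
    then have s[measurable]: "s \<in> space (states M)" using sets_eq_imp_space_eq[OF sets] by simp
    have "\<pi> s \<in> space (prob_algebra (actions M))" using \<pi>m s by (rule measurable_space)
    then have sets\<pi>: "sets (\<pi> s) = sets (actions M)" by (simp add: space_prob_algebra)
    have "(\<lambda>a. return (state_actions M) (s, a)) \<in> actions M \<rightarrow>\<^sub>M prob_algebra (state_actions M)"
      by measurable
    then have "(\<lambda>a. return (state_actions M) (s, a)) \<in> \<pi> s \<rightarrow>\<^sub>M subprob_algebra (state_actions M)"
      using sets\<pi> measurable_prob_algebraD by (simp cong: measurable_cong_sets)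
    then have "(\<integral>\<^sup>+x. f x \<partial>(\<pi> s \<bind> (\<lambda>a. return (state_actions M) (s, a))))
        = (\<integral>\<^sup>+a. (\<integral>\<^sup>+x. f x \<partial>return (state_actions M) (s, a)) \<partial>\<pi> s)"
      by (intro nn_integral_bind[OF f])
    also have "\<dots> = (\<integral>\<^sup>+a. f (s, a) \<partial>\<pi> s)"
      using sets_eq_imp_space_eq[OF sets\<pi>] s
      by (intro nn_integral_cong nn_integral_return) (auto simp: space_pair_measure)
    finally show "(\<integral>\<^sup>+x. f x \<partial>(\<pi> s \<bind> (\<lambda>a. return (state_actions M) (s, a)))) = (\<integral>\<^sup>+a. f (s, a) \<partial>\<pi> s)" .
  qed
  finally show ?thesis .
qed

section \<open>The chain of state-action pairs and its transition operator\<close>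

definition next_mean ::
    "('s, 'a) mdp \<Rightarrow> ('s \<Rightarrow> 'a measure) \<Rightarrow> ('s \<times> 'a \<Rightarrow> 's measure) \<Rightarrow>
     ('s \<times> 'a \<Rightarrow> ennreal) \<Rightarrow> 's \<times> 'a \<Rightarrow> ennreal" where
  "next_mean M \<pi> Q f x = (\<integral>\<^sup>+y. f y \<partial>choose_action M \<pi> (Q x))"

locale mdp_process =
  fixes M :: "('s, 'a) mdp" and \<pi> :: "'s \<Rightarrow> 'a measure" and Q :: "'s \<times> 'a \<Rightarrow> 's measure"
  assumes policy: "\<pi> \<in> policies M"
    and kernel: "Q \<in> transition_kernels M"
    and initial: "initial M \<in> space (prob_algebra (states M))"
begin

lemma measurable_step:
  "(\<lambda>x. choose_action M \<pi> (Q x)) \<in> state_actions M \<rightarrow>\<^sub>M prob_algebra (state_actions M)"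
  using measurable_compose[OF _ measurable_choose_action[OF policy]] kernel
  by (simp add: transition_kernels_def)

lemma measurable_next_mean[measurable]:
  assumes [measurable]: "f \<in> borel_measurable (state_actions M)"
  shows "next_mean M \<pi> Q f \<in> borel_measurable (state_actions M)"
proof -
  have "(\<lambda>x. \<integral>\<^sup>+y. f y \<partial>choose_action M \<pi> (Q x)) \<in> borel_measurable (state_actions M)"
    using measurable_prob_algebraD[OF measurable_step]
    by (rule nn_integral_measurable_subprob_algebra2[rotated]) measurable
  then show ?thesis by (simp add: next_mean_def[abs_def])
qed

lemma measurable_next_mean_funpow[measurable]:
  "f \<in> borel_measurable (state_actions M) \<Longrightarrow>
    (next_mean M \<pi> Q ^^ n) f \<in> borel_measurable (state_actions M)"
  by (induction n) auto

lemma measurable_step_law: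
  "step_law M Q \<pi> i \<in> PiM {0..<i} (\<lambda>_. state_actions M) \<rightarrow>\<^sub>M prob_algebra (state_actions M)"
proof (cases i)
  case 0
  then show ?thesis
    using measurable_space[OF measurable_choose_action[OF policy] initial]
    by (simp cong: measurable_cong)
next
  case (Suc n)
  have "(\<lambda>\<omega>. choose_action M \<pi> (Q (\<omega> n)))
      \<in> PiM {0..<Suc n} (\<lambda>_. state_actions M) \<rightarrow>\<^sub>M prob_algebra (state_actions M)"
    by (rule measurable_compose[OF _ measurable_step]) (auto intro: measurable_component_singleton)
  then show ?thesis unfolding Suc by (simp cong: measurable_cong)
qed

sublocale IT: Ionescu_Tulcea "step_law M Q \<pi>" "\<lambda>_. state_actions M"
proof (rule Ionescu_Tulcea.intro)
  show "step_law M Q \<pi> i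
      \<in> PiM {0..<i} (\<lambda>_. state_actions M) \<rightarrow>\<^sub>M subprob_algebra (state_actions M)" for i
    by (rule measurable_prob_algebraD[OF measurable_step_law])
  show "prob_space (step_law M Q \<pi> i x)" if "x \<in> space (PiM {0..<i} (\<lambda>_. state_actions M))" for i x
    using measurable_space[OF measurable_step_law that] by (simp add: space_prob_algebra)
qed

lemma trajectory_eq: "trajectory M Q \<pi> = IT.PF.lim"
  by (simp add: trajectory_def)

lemma sets_trajectory[measurable_cong]:
  "sets (trajectory M Q \<pi>) = sets (PiM UNIV (\<lambda>_. state_actions M))"
  by (simp add: trajectory_eq)

lemma measurable_coordinate[measurable]: "(\<lambda>\<omega>. \<omega> n) \<in> trajectory M Q \<pi> \<rightarrow>\<^sub>M state_actions M"
  by (simp add: measurable_cong_sets[OF sets_trajectory] measurable_component_singleton)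

text \<open>\<open>IT.C 0 (Suc n)\<close> is the joint law of the pairs with indices
  \<open>0..n\<close>, started from the empty history \<open>\<lambda>_. undefined\<close>.
  Integrating out the last pair replaces \<open>f\<close> by \<open>next_mean M \<pi> Q f\<close>
  one index earlier, so the induction must leave \<open>f\<close> arbitrary.\<close>

lemma nn_integral_C:
  assumes "f \<in> borel_measurable (state_actions M)"
  shows "(\<integral>\<^sup>+\<omega>. f (\<omega> n) \<partial>IT.C 0 (Suc n) (\<lambda>_. undefined))
    = (\<integral>\<^sup>+x. (next_mean M \<pi> Q ^^ n) f x \<partial>choose_action M \<pi> (initial M))"
  using assms
proof (induction n arbitrary: f)
  case (0 f)
  note [measurable] = 0
  have "(\<integral>\<^sup>+\<omega>. f (\<omega> 0) \<partial>IT.C 0 (Suc 0) (\<lambda>_. undefined)) = (\<integral>\<^sup>+\<omega>. f (\<omega> 0) \<partial>IT.eP 0 (\<lambda>_. undefined))"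
    using bind_return[OF IT.measurable_eP[of 0], of "\<lambda>_. undefined"] by simp
  also have "\<dots> = (\<integral>\<^sup>+x. f x \<partial>choose_action M \<pi> (initial M))"
    by (subst IT.nn_integral_eP) auto
  finally show ?case by simp
next
  case (Suc n f)
  note [measurable] = Suc.prems
  let ?u = "\<lambda>_. undefined"
  have "(\<integral>\<^sup>+\<omega>. f (\<omega> (Suc n)) \<partial>IT.C 0 (Suc (Suc n)) ?u)
      = (\<integral>\<^sup>+\<omega>. (\<integral>\<^sup>+\<omega>'. f (\<omega>' (Suc n)) \<partial>IT.eP (Suc n) \<omega>) \<partial>IT.C 0 (Suc n) ?u)"
    by (simp del: IT.C.simps add: IT.C.simps(2)[of 0 "Suc n"],
        subst nn_integral_bind[where B="PiM {0..<Suc (Suc n)} (\<lambda>_. state_actions M)"])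
       (auto simp del: IT.C.simps cong: measurable_cong_sets simp: measurable_cong_sets[OF IT.sets_C])
  also have "\<dots> = (\<integral>\<^sup>+\<omega>. next_mean M \<pi> Q f (\<omega> n) \<partial>IT.C 0 (Suc n) ?u)"
    by (intro nn_integral_cong)
       (auto simp: IT.space_C IT.nn_integral_eP next_mean_def simp del: IT.C.simps)
  also have "\<dots> = (\<integral>\<^sup>+x. (next_mean M \<pi> Q ^^ n) (next_mean M \<pi> Q f) x \<partial>choose_action M \<pi> (initial M))"
    by (rule Suc.IH) measurable
  finally show ?case by (simp add: funpow_swap1)
qed

text \<open>Coordinate \<open>n\<close> is determined by the restriction to
  \<open>{0..<Suc n}\<close>, and the projective limit prescribes the law of that restriction. This
  reduces the infinite trajectory to the finite-horizon computation.\<close>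

lemma nn_integral_trajectory:
  assumes f[measurable]: "f \<in> borel_measurable (state_actions M)"
  shows "(\<integral>\<^sup>+\<omega>. f (\<omega> n) \<partial>trajectory M Q \<pi>)
    = (\<integral>\<^sup>+x. (next_mean M \<pi> Q ^^ n) f x \<partial>choose_action M \<pi> (initial M))"
proof -
  let ?X = "\<lambda>_::nat. state_actions M"
  \<comment> \<open>\<open>IT.CI J\<close> is built from the chain run up to the least horizon that
    covers \<open>J\<close>; for an initial segment this horizon is its length.\<close>
  have up_to: "IT.up_to {0..<Suc n} = Suc n"
    by (intro antisym) (use IT.up_to_less[of "{0..<Suc n}" n] in \<open>auto simp: IT.up_to_iff\<close>)
  have "(\<integral>\<^sup>+\<omega>. f (\<omega> n) \<partial>trajectory M Q \<pi>)
      = (\<integral>\<^sup>+\<omega>. f (\<omega> n) \<partial>distr (trajectory M Q \<pi>) (PiM {0..<Suc n} ?X) (\<lambda>x. restrict x {0..<Suc n}))"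
    by (subst nn_integral_distr) (auto simp: measurable_cong_sets[OF sets_trajectory])
  also have "\<dots> = (\<integral>\<^sup>+\<omega>. f (\<omega> n) \<partial>IT.CI {0..<Suc n})"
    by (simp add: trajectory_eq IT.distr_lim)
  also have "\<dots> = (\<integral>\<^sup>+\<omega>. f (\<omega> n) \<partial>IT.C 0 (Suc n) (\<lambda>_. undefined))"
    unfolding IT.CI_def up_to
    by (subst nn_integral_distr)
       (auto simp: measurable_cong_sets[OF IT.sets_C] simp del: IT.C.simps intro!: measurable_restrict)
  finally show ?thesis using nn_integral_C[OF f] by simp
qed

lemma prob_space_initial_pair: "prob_space (choose_action M \<pi> (initial M))"
  using measurable_space[OF measurable_choose_action[OF policy] initial]
  by (simp add: space_prob_algebra)

lemma space_step:
  "x \<in> space (state_actions M) \<Longrightarrow> space (choose_action M \<pi> (Q x)) = space (state_actions M)"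
  using measurable_space[OF measurable_step, of x]
  by (intro sets_eq_imp_space_eq) (simp add: space_prob_algebra)

lemma prob_space_step:
  "x \<in> space (state_actions M) \<Longrightarrow> prob_space (choose_action M \<pi> (Q x))"
  using measurable_space[OF measurable_step, of x] by (simp add: space_prob_algebra)

lemma next_mean_le:
  assumes "\<And>y. y \<in> space (state_actions M) \<Longrightarrow> f y \<le> c" and x: "x \<in> space (state_actions M)"
  shows "next_mean M \<pi> Q f x \<le> c"
proof -
  have "next_mean M \<pi> Q f x \<le> (\<integral>\<^sup>+y. c \<partial>choose_action M \<pi> (Q x))"
    unfolding next_mean_def using assms by (intro nn_integral_mono) (simp add: space_step)
  then show ?thesis using prob_space.emeasure_space_1[OF prob_space_step[OF x]] by simp
qed

lemma next_mean_funpow_le: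
  assumes "\<And>y. y \<in> space (state_actions M) \<Longrightarrow> f y \<le> c" and "x \<in> space (state_actions M)"
  shows "(next_mean M \<pi> Q ^^ n) f x \<le> c"
  using assms by (induction n arbitrary: x) (auto intro!: next_mean_le)

lemma prob_space_trajectory: "prob_space (trajectory M Q \<pi>)"
proof
  have "emeasure (trajectory M Q \<pi>) (space (trajectory M Q \<pi>)) = (\<integral>\<^sup>+\<omega>. 1 \<partial>trajectory M Q \<pi>)"
    by simp
  also have "\<dots> = (\<integral>\<^sup>+x. 1 \<partial>choose_action M \<pi> (initial M))"
    using nn_integral_trajectory[of "\<lambda>_. 1" 0] by simp
  also have "\<dots> = 1" using prob_space.emeasure_space_1[OF prob_space_initial_pair] by simp
  finally show "emeasure (trajectory M Q \<pi>) (space (trajectory M Q \<pi>)) = 1" .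
qed

text \<open>This one-step Markov property in expectation links consecutive terms of the telescoping
  argument for the value difference.\<close>

lemma nn_integral_trajectory_Suc:
  assumes "f \<in> borel_measurable (state_actions M)"
  shows "(\<integral>\<^sup>+\<omega>. f (\<omega> (Suc n)) \<partial>trajectory M Q \<pi>) = (\<integral>\<^sup>+\<omega>. next_mean M \<pi> Q f (\<omega> n) \<partial>trajectory M Q \<pi>)"
  using assms by (simp add: nn_integral_trajectory funpow_swap1)

end

section \<open>Values and occupancy\<close>

text \<open>This is Cauchy--Schwarz against the constant 1. The integral of the squared deviation of
  \<open>g\<close> from its mean is nonnegative and expands to \<open>?B - ?A\<^sup>2 / ?m\<close>.
  The null measure is split off because it has no mean; boundedness provides integrability.\<close>

lemma (in finite_measure) square_integral_le:
  fixes g :: "'a \<Rightarrow> real"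
  assumes g: "g \<in> borel_measurable M" and bnd: "\<And>x. x \<in> space M \<Longrightarrow> \<bar>g x\<bar> \<le> c"
  shows "(integral\<^sup>L M g)\<^sup>2 \<le> measure M (space M) * (\<integral>x. (g x)\<^sup>2 \<partial>M)"
proof (cases "measure M (space M) = 0")
  case True
  then have "AE x in M. g x = 0"
    by (intro AE_I[of _ _ "space M"]) (auto simp: emeasure_eq_measure)
  then show ?thesis using True by (simp add: integral_eq_zero_AE)
next
  case False
  let ?m = "measure M (space M)" and ?A = "integral\<^sup>L M g" and ?B = "\<integral>x. (g x)\<^sup>2 \<partial>M"
  have m: "?m > 0" using False by (simp add: zero_less_measure_iff)
  have "(g x)\<^sup>2 \<le> c\<^sup>2" if "x \<in> space M" for x
    using bnd[OF that] by (intro power2_le_iff_abs_le[THEN iffD2]) auto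
  then have int: "integrable M g" "integrable M (\<lambda>x. (g x)\<^sup>2)"
    using g bnd
    by (auto intro: integrable_const_bound[where B=c] integrable_const_bound[where B="c\<^sup>2"])
  have "0 \<le> (\<integral>x. (g x - ?A / ?m)\<^sup>2 \<partial>M)" by simp
  also have "(\<lambda>x. (g x - ?A / ?m)\<^sup>2) = (\<lambda>x. (g x)\<^sup>2 - 2 * (?A / ?m) * g x + (?A / ?m)\<^sup>2)"
    by (simp add: power2_diff algebra_simps)
  also have "(\<integral>x. (g x)\<^sup>2 - 2 * (?A / ?m) * g x + (?A / ?m)\<^sup>2 \<partial>M)
      = ?B - 2 * (?A / ?m) * ?A + (?A / ?m)\<^sup>2 * ?m"
    using int by simp
  also have "\<dots> = ?B - ?A\<^sup>2 / ?m" using m by (simp add: field_simps power2_eq_square)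
  finally show ?thesis using m by (simp add: field_simps)
qed

section \<open>Action values, state values and the Bellman equation\<close>

definition action_value ::
    "('s, 'a) mdp \<Rightarrow> ('s \<Rightarrow> 'a measure) \<Rightarrow> ('s \<times> 'a \<Rightarrow> 's measure) \<Rightarrow> 's \<times> 'a \<Rightarrow> ennreal" where
  "action_value M \<pi> Q x =
     (\<Sum>t. ennreal (discount M ^ t) * (next_mean M \<pi> Q ^^ t) (\<lambda>y. ennreal (reward M y)) x)"

text \<open>Real-valued because the inequalities on differences of means concern real functions. On
  states of the process \<open>enn2real\<close> loses nothing, since the integral is at most
  \<open>Rmax / (1 - discount M)\<close>.\<close>

definition state_value ::
    "('s, 'a) mdp \<Rightarrow> ('s \<Rightarrow> 'a measure) \<Rightarrow> ('s \<times> 'a \<Rightarrow> 's measure) \<Rightarrow> 's \<Rightarrow> real" where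
  "state_value M \<pi> Q s = enn2real (\<integral>\<^sup>+a. action_value M \<pi> Q (s, a) \<partial>\<pi> s)"

locale discounted_process = mdp_process M \<pi> Q
  for M :: "('s, 'a) mdp" and \<pi> Q +
  fixes Rmax :: real
  assumes discount: "0 < discount M" "discount M < 1"
    and measurable_reward[measurable]: "reward M \<in> borel_measurable (state_actions M)"
    and reward_bounds: "\<And>x. x \<in> space (state_actions M) \<Longrightarrow> 0 \<le> reward M x \<and> reward M x \<le> Rmax"
begin

lemma sums_geometric: "(\<lambda>t. discount M ^ t * c) sums (c / (1 - discount M))"
  using sums_mult2[OF geometric_sums[of "discount M"], of c] discount by (simp add: field_simps)

lemma suminf_geometric:
  assumes "0 \<le> c"
  shows "(\<Sum>t. ennreal (discount M ^ t) * ennreal c) = ennreal (c / (1 - discount M))"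
proof -
  have "(\<Sum>t. ennreal (discount M ^ t) * ennreal c) = (\<Sum>t. ennreal (discount M ^ t * c))"
    using assms discount by (intro suminf_cong ennreal_mult[symmetric]) auto
  also have "\<dots> = ennreal (c / (1 - discount M))"
    using assms discount by (intro suminf_ennreal_eq[OF _ sums_geometric]) auto
  finally show ?thesis .
qed

lemma suminf_le_geometric:
  assumes "\<And>t. f t \<le> ennreal c" and "0 \<le> c"
  shows "(\<Sum>t. ennreal (discount M ^ t) * f t) \<le> ennreal (c / (1 - discount M))"
proof -
  have "(\<Sum>t. ennreal (discount M ^ t) * f t) \<le> (\<Sum>t. ennreal (discount M ^ t) * ennreal c)"
    using assms(1) by (intro suminf_le mult_left_mono summableI) simp_all
  then show ?thesis using suminf_geometric[OF assms(2)] by simp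
qed

sublocale traj: prob_space "trajectory M Q \<pi>"
  by (rule prob_space_trajectory)

lemma space_coordinate:
  "\<omega> \<in> space (trajectory M Q \<pi>) \<Longrightarrow> \<omega> t \<in> space (state_actions M)"
  by (rule measurable_space[OF measurable_coordinate])

text \<open>The reward bounds carry a sign only if some state-action pair exists. A probability
  space of trajectories is nonempty, and any trajectory provides such a pair.\<close>

lemma Rmax_nonneg: "0 \<le> Rmax"
proof -
  obtain \<omega> where "\<omega> \<in> space (trajectory M Q \<pi>)" using traj.not_empty by blast
  then show ?thesis using reward_bounds[OF space_coordinate, of \<omega> 0] by simp
qed

lemma integrable_trajectory:
  assumes "f \<in> borel_measurable (state_actions M)"
    and "\<And>x. x \<in> space (state_actions M) \<Longrightarrow> \<bar>f x\<bar> \<le> (c::real)"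
  shows "integrable (trajectory M Q \<pi>) (\<lambda>\<omega>. f (\<omega> t))"
proof (rule traj.integrable_const_bound[where B=c])
  show "AE \<omega> in trajectory M Q \<pi>. norm (f (\<omega> t)) \<le> c"
    using assms(2)[OF space_coordinate] by (intro AE_I2) simp
  show "(\<lambda>\<omega>. f (\<omega> t)) \<in> borel_measurable (trajectory M Q \<pi>)"
    using measurable_coordinate assms(1) by (rule measurable_compose)
qed

lemma nn_integral_trajectory_real:
  assumes "f \<in> borel_measurable (state_actions M)"
    and "\<And>x. x \<in> space (state_actions M) \<Longrightarrow> 0 \<le> f x \<and> f x \<le> (c::real)"
  shows "(\<integral>\<^sup>+\<omega>. ennreal (f (\<omega> t)) \<partial>trajectory M Q \<pi>) = ennreal (\<integral>\<omega>. f (\<omega> t) \<partial>trajectory M Q \<pi>)"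
proof (rule nn_integral_eq_integral)
  show "integrable (trajectory M Q \<pi>) (\<lambda>\<omega>. f (\<omega> t))"
    by (rule integrable_trajectory[OF assms(1), of c]) (use assms(2) in fastforce)
  show "AE \<omega> in trajectory M Q \<pi>. 0 \<le> f (\<omega> t)"
    using assms(2)[OF space_coordinate] by (intro AE_I2) blast
qed

text \<open>Expectation and series may be exchanged because the terms are dominated by the geometric
  series \<open>discount M ^ t * Rmax\<close>.\<close>

lemma policy_value_sums:
  "(\<lambda>t. discount M ^ t * (\<integral>\<omega>. reward M (\<omega> t) \<partial>trajectory M Q \<pi>)) sums policy_value M \<pi> Q"
proof -
  let ?T = "trajectory M Q \<pi>"
  let ?f = "\<lambda>t \<omega>. discount M ^ t * reward M (\<omega> t)"
  have i: "integrable ?T (?f t)" for t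
    using reward_bounds by (auto intro!: integrable_trajectory[where c=Rmax])
  have n: "norm (?f t \<omega>) \<le> discount M ^ t * Rmax" if "\<omega> \<in> space ?T" for t \<omega>
    using reward_bounds[OF space_coordinate[OF that, of t]] discount by (simp add: abs_mult)
  have "summable (\<lambda>t. norm (?f t \<omega>))" if "\<omega> \<in> space ?T" for \<omega>
    using n[OF that] by (intro summable_comparison_test'[OF sums_summable[OF sums_geometric]]) auto
  moreover have "summable (\<lambda>t. \<integral>\<omega>. norm (?f t \<omega>) \<partial>?T)"
    using n i by (intro summable_comparison_test'[OF sums_summable[OF sums_geometric[of Rmax]]])
      (auto intro!: traj.integral_le_const)
  ultimately have "(\<lambda>t. \<integral>\<omega>. ?f t \<omega> \<partial>?T) sums (\<integral>\<omega>. (\<Sum>t. ?f t \<omega>) \<partial>?T)"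
    by (intro sums_integral i AE_I2)
  then show ?thesis by (simp add: policy_value_def)
qed

lemma ennreal_policy_value:
  "ennreal (policy_value M \<pi> Q)
    = (\<Sum>t. ennreal (discount M ^ t) * (\<integral>\<^sup>+\<omega>. ennreal (reward M (\<omega> t)) \<partial>trajectory M Q \<pi>))"
proof -
  have *: "0 \<le> (\<integral>\<omega>. reward M (\<omega> t) \<partial>trajectory M Q \<pi>)" for t
    using reward_bounds space_coordinate by (intro integral_nonneg_AE AE_I2) auto
  have "ennreal (policy_value M \<pi> Q)
      = (\<Sum>t. ennreal (discount M ^ t * (\<integral>\<omega>. reward M (\<omega> t) \<partial>trajectory M Q \<pi>)))"
    by (rule suminf_ennreal_eq[OF _ policy_value_sums, symmetric]) (use * discount in auto)
  then show ?thesis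
    using * discount reward_bounds by (simp add: ennreal_mult nn_integral_trajectory_real[where c=Rmax])
qed

lemma measurable_action_value[measurable]:
  "action_value M \<pi> Q \<in> borel_measurable (state_actions M)"
  unfolding action_value_def by measurable

lemma action_value_le:
  assumes "x \<in> space (state_actions M)"
  shows "action_value M \<pi> Q x \<le> ennreal (Rmax / (1 - discount M))"
  unfolding action_value_def using assms reward_bounds Rmax_nonneg
  by (intro suminf_le_geometric next_mean_funpow_le) (auto intro: ennreal_leI)

text \<open>Monotone convergence, for a general \<mu> because it is applied both to the one-step
  laws and to the law of the initial pair.\<close>

lemma nn_integral_action_value:
  assumes "sets \<mu> = sets (state_actions M)"
  shows "(\<integral>\<^sup>+x. action_value M \<pi> Q x \<partial>\<mu>)
    = (\<Sum>t. ennreal (discount M ^ t)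
         * (\<integral>\<^sup>+x. (next_mean M \<pi> Q ^^ t) (\<lambda>y. ennreal (reward M y)) x \<partial>\<mu>))"
proof -
  have [measurable]: "(next_mean M \<pi> Q ^^ t) (\<lambda>y. ennreal (reward M y)) \<in> borel_measurable \<mu>" for t
    using measurable_next_mean_funpow[of "\<lambda>y. ennreal (reward M y)" t] assms
    by (simp cong: measurable_cong_sets)
  show ?thesis
    unfolding action_value_def by (subst nn_integral_suminf) (auto intro!: suminf_cong nn_integral_cmult)
qed

lemma sets_step:
  "x \<in> space (state_actions M) \<Longrightarrow> sets (choose_action M \<pi> (Q x)) = sets (state_actions M)"
  using measurable_space[OF measurable_step, of x] by (simp add: space_prob_algebra)

text \<open>The term with index 0 of the series is the reward. The operator \<open>next_mean\<close>
  passes through the series, and the extra discount factor turns the result into the tail starting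
  at index 1.\<close>

lemma Bellman_equation:
  assumes x: "x \<in> space (state_actions M)"
  shows "action_value M \<pi> Q x
    = ennreal (reward M x) + ennreal (discount M) * next_mean M \<pi> Q (action_value M \<pi> Q) x"
proof -
  let ?R = "\<lambda>y. ennreal (reward M y)"
  define f where "f t = ennreal (discount M ^ t) * (next_mean M \<pi> Q ^^ t) ?R x" for t
  have "next_mean M \<pi> Q (action_value M \<pi> Q) x
      = (\<Sum>t. ennreal (discount M ^ t) * (next_mean M \<pi> Q ^^ Suc t) ?R x)"
    unfolding next_mean_def[of _ _ _ "action_value M \<pi> Q"]
    by (subst nn_integral_action_value[OF sets_step[OF x]]) (simp add: next_mean_def)
  then have "ennreal (discount M) * next_mean M \<pi> Q (action_value M \<pi> Q) x
      = (\<Sum>t. ennreal (discount M) * (ennreal (discount M ^ t) * (next_mean M \<pi> Q ^^ Suc t) ?R x))"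
    by (simp only: ennreal_suminf_cmult)
  also have "\<dots> = (\<Sum>t. f (Suc t))"
    using discount by (intro suminf_cong) (simp add: f_def ennreal_mult mult.assoc)
  finally have "ennreal (discount M) * next_mean M \<pi> Q (action_value M \<pi> Q) x = (\<Sum>t. f (Suc t))" .
  then have "(\<lambda>t. f (Suc t)) sums (ennreal (discount M) * next_mean M \<pi> Q (action_value M \<pi> Q) x)"
    by (simp add: summable_sums summableI)
  then have "f sums (ennreal (discount M) * next_mean M \<pi> Q (action_value M \<pi> Q) x + f 0)"
    by (rule sums_Suc)
  then have "suminf f = ennreal (discount M) * next_mean M \<pi> Q (action_value M \<pi> Q) x + f 0"
    by (rule sums_unique[symmetric])
  moreover have "action_value M \<pi> Q x = suminf f"
    unfolding action_value_def f_def ..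
  moreover have "f 0 = ennreal (reward M x)"
    by (simp add: f_def)
  ultimately show ?thesis by (simp only: add.commute)
qed

lemma ennreal_policy_value_initial:
  "ennreal (policy_value M \<pi> Q) = (\<integral>\<^sup>+x. action_value M \<pi> Q x \<partial>choose_action M \<pi> (initial M))"
proof -
  have "sets (choose_action M \<pi> (initial M)) = sets (state_actions M)"
    using measurable_space[OF measurable_choose_action[OF policy] initial]
    by (simp add: space_prob_algebra)
  then show ?thesis
    using nn_integral_trajectory[of "\<lambda>x. ennreal (reward M x)"]
    by (simp add: nn_integral_action_value ennreal_policy_value)
qed

lemma state_value_eq:
  assumes s: "s \<in> space (states M)"
  shows "(\<integral>\<^sup>+a. action_value M \<pi> Q (s, a) \<partial>\<pi> s) = ennreal (state_value M \<pi> Q s)"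
    and "state_value M \<pi> Q s \<in> {0..Rmax / (1 - discount M)}"
proof -
  have "\<pi> s \<in> space (prob_algebra (actions M))"
    using policy s by (auto simp: policies_def intro: measurable_space)
  then have p: "prob_space (\<pi> s)" and sp: "space (\<pi> s) = space (actions M)"
    by (auto simp: space_prob_algebra dest: sets_eq_imp_space_eq)
  have "(\<integral>\<^sup>+a. action_value M \<pi> Q (s, a) \<partial>\<pi> s)
      \<le> (\<integral>\<^sup>+a. ennreal (Rmax / (1 - discount M)) \<partial>\<pi> s)"
    using s sp by (intro nn_integral_mono action_value_le) (auto simp: space_pair_measure)
  also have "\<dots> = ennreal (Rmax / (1 - discount M))"
    using prob_space.emeasure_space_1[OF p] by simp
  finally have le: "(\<integral>\<^sup>+a. action_value M \<pi> Q (s, a) \<partial>\<pi> s) \<le> ennreal (Rmax / (1 - discount M))" .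
  then show eq: "(\<integral>\<^sup>+a. action_value M \<pi> Q (s, a) \<partial>\<pi> s) = ennreal (state_value M \<pi> Q s)"
    unfolding state_value_def by (intro ennreal_enn2real[symmetric]) (auto intro: le_less_trans)
  show "state_value M \<pi> Q s \<in> {0..Rmax / (1 - discount M)}"
    using le unfolding eq using Rmax_nonneg discount by (auto simp: state_value_def)
qed

lemma measurable_state_value[measurable]: "state_value M \<pi> Q \<in> borel_measurable (states M)"
proof -
  have [measurable]: "\<pi> \<in> states M \<rightarrow>\<^sub>M subprob_algebra (actions M)"
    using policy by (auto simp: policies_def intro: measurable_prob_algebraD)
  have "(\<lambda>s. \<integral>\<^sup>+a. action_value M \<pi> Q (s, a) \<partial>\<pi> s) \<in> borel_measurable (states M)"
    by (rule nn_integral_measurable_subprob_algebra2[where N="actions M"]) measurable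
  then show ?thesis by (auto simp: state_value_def[abs_def])
qed

end

section \<open>Occupancy integrals and the difference of values\<close>

lemma nn_integral_occupancy:
  assumes "discounted_process M \<pi> (transition M) Rmax"
    and f[measurable]: "f \<in> borel_measurable (state_actions M)"
  shows "(\<integral>\<^sup>+x. f x \<partial>occupancy M \<pi>)
    = (\<Sum>t. ennreal (discount M ^ t) * (\<integral>\<^sup>+\<omega>. f (\<omega> t) \<partial>trajectory M (transition M) \<pi>))"
proof -
  interpret discounted_process M \<pi> "transition M" Rmax by fact
  let ?T = "trajectory M (transition M) \<pi>"
  \<comment> \<open>\<open>occupancy\<close> is given by a set function whose countable additivity
    is not yet known. The geometric weights on times, multiplied by the trajectory law and pushed
    forward under evaluation at the time, form a genuine measure with the same values, and Tonelli's
    theorem computes its integrals.\<close>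
  let ?G = "density (count_space UNIV) (\<lambda>t. ennreal (discount M ^ t))"
  let ?N = "distr (?G \<Otimes>\<^sub>M ?T) (state_actions M) (\<lambda>(t, \<omega>). \<omega> t)"
  have m[measurable]: "(\<lambda>(t, \<omega>). \<omega> t) \<in> ?G \<Otimes>\<^sub>M ?T \<rightarrow>\<^sub>M state_actions M"
  proof -
    have "(\<lambda>p. (\<lambda>(t, \<omega>). \<omega> t) p) \<in> count_space UNIV \<Otimes>\<^sub>M ?T \<rightarrow>\<^sub>M state_actions M"
      by (rule measurable_pair_measure_countable1) (auto intro: measurable_coordinate)
    then show ?thesis
      by (subst measurable_cong_sets[OF sets_pair_measure_cong refl]) auto
  qed
  have int: "(\<integral>\<^sup>+x. g x \<partial>?N) = (\<Sum>t. ennreal (discount M ^ t) * (\<integral>\<^sup>+\<omega>. g (\<omega> t) \<partial>?T))"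
    if [measurable]: "g \<in> borel_measurable (state_actions M)" for g
  proof -
    have "(\<integral>\<^sup>+x. g x \<partial>?N) = (\<integral>\<^sup>+p. g (snd p (fst p)) \<partial>(?G \<Otimes>\<^sub>M ?T))"
      by (subst nn_integral_distr[OF m]) (simp_all add: split_beta that)
    also have "\<dots> = (\<integral>\<^sup>+t. (\<integral>\<^sup>+\<omega>. g (\<omega> t) \<partial>?T) \<partial>?G)"
      using measurable_compose[OF m that]
      by (subst traj.nn_integral_fst[symmetric]) (simp_all add: split_beta)
    also have "\<dots> = (\<Sum>t. ennreal (discount M ^ t) * (\<integral>\<^sup>+\<omega>. g (\<omega> t) \<partial>?T))"
      by (subst nn_integral_density) (auto simp: nn_integral_count_space_nat)
    finally show ?thesis .
  qed
  have "occupancy M \<pi> = ?N"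
  proof -
    have "occupancy M \<pi> = measure_of (space (state_actions M)) (sets (state_actions M)) (emeasure ?N)"
      unfolding occupancy_def
    \<comment> \<open>It suffices that the two set functions agree on measurable sets; additivity is
      then inherited from \<open>?N\<close>.\<close>
    proof (rule measure_of_eq)
      show "sets (state_actions M) \<subseteq> Pow (space (state_actions M))" by (rule sets.space_closed)
      fix B assume "B \<in> sigma_sets (space (state_actions M)) (sets (state_actions M))"
      then have B[measurable]: "B \<in> sets (state_actions M)" by (simp add: sets.sigma_sets_eq)
      have ind: "(\<lambda>\<omega>. indicator B (\<omega> t) :: ennreal) \<in> borel_measurable ?T" for t
        using measurable_coordinate by (rule measurable_compose) measurable
      have "emeasure ?N B = (\<integral>\<^sup>+x. indicator B x \<partial>?N)" by simp
      also have "\<dots> = (\<Sum>t. ennreal (discount M ^ t) * (\<integral>\<^sup>+\<omega>. indicator B (\<omega> t) \<partial>?T))"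
        by (rule int) measurable
      also have "\<dots> = (\<integral>\<^sup>+\<omega>. (\<Sum>t. ennreal (discount M ^ t) * indicator B (\<omega> t)) \<partial>?T)"
        using ind by (subst nn_integral_suminf) (auto intro!: suminf_cong nn_integral_cmult[symmetric])
      finally show "(\<integral>\<^sup>+\<omega>. (\<Sum>t. ennreal (discount M ^ t) * indicator B (\<omega> t)) \<partial>?T) = emeasure ?N B"
        by simp
    qed
    also have "\<dots> = ?N"
      using measure_of_of_measure[of ?N] by simp
    finally show ?thesis .
  qed
  then show ?thesis using int[OF f] by simp
qed

text \<open>\<open>b\<close> is the one-step model error, measured on the value function of
  \<open>Q\<close>. The difference stays a signed series along true trajectories, since the
  occupancy identity is for nonnegative integrands; absolute values enter only afterwards.
  Measurability and the bound on \<open>b\<close> make that passage possible.\<close>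

lemma simulation_lemma:
  fixes M :: "('s, 'a) mdp"
  assumes P: "discounted_process M \<pi> (transition M) Rmax" and Q: "discounted_process M \<pi> Q Rmax"
  defines "b \<equiv> \<lambda>x. (\<integral>s. state_value M \<pi> Q s \<partial>transition M x) - (\<integral>s. state_value M \<pi> Q s \<partial>Q x)"
  shows "(\<lambda>t. discount M * (discount M ^ t * (\<integral>\<omega>. b (\<omega> t) \<partial>trajectory M (transition M) \<pi>)))
      sums (policy_value M \<pi> (transition M) - policy_value M \<pi> Q)"
    and "b \<in> borel_measurable (state_actions M)"
    and "\<And>x. x \<in> space (state_actions M) \<Longrightarrow> \<bar>b x\<bar> \<le> Rmax / (1 - discount M)"
proof -
  interpret P: discounted_process M \<pi> "transition M" Rmax by fact
  interpret Q: discounted_process M \<pi> Q Rmax by fact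
  let ?X = "state_actions M" and ?T = "trajectory M (transition M) \<pi>" and ?\<gamma> = "discount M"
  define L where "L = Rmax / (1 - ?\<gamma>)"
  define v where "v = state_value M \<pi> Q"
  define w where "w x = enn2real (action_value M \<pi> Q x)" for x
  define bP where "bP x = (\<integral>s. v s \<partial>transition M x)" for x
  define bQ where "bQ x = (\<integral>s. v s \<partial>Q x)" for x
  have b: "b = (\<lambda>x. bP x - bQ x)" by (simp add: b_def bP_def bQ_def v_def)
  have v01: "0 \<le> v s \<and> v s \<le> L" if "s \<in> space (states M)" for s
    using Q.state_value_eq(2)[OF that] by (simp add: v_def L_def)
  have vm[measurable]: "v \<in> borel_measurable (states M)" unfolding v_def by measurable
  \<comment> \<open>This is used with \<open>K\<close> the true kernel and with
    \<open>K = Q\<close>. The value function is that of \<open>Q\<close> in both cases; only the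
    averaging kernel changes.\<close>
  have means: "(\<lambda>x. \<integral>s. v s \<partial>K x) \<in> borel_measurable ?X"
    "\<And>x. x \<in> space ?X \<Longrightarrow> 0 \<le> (\<integral>s. v s \<partial>K x) \<and> (\<integral>s. v s \<partial>K x) \<le> L"
    "\<And>x. x \<in> space ?X \<Longrightarrow> next_mean M \<pi> K (action_value M \<pi> Q) x = ennreal (\<integral>s. v s \<partial>K x)"
    if K: "K \<in> transition_kernels M" for K
  proof -
    have Km: "K \<in> ?X \<rightarrow>\<^sub>M prob_algebra (states M)" using K by (simp add: transition_kernels_def)
    show "(\<lambda>x. \<integral>s. v s \<partial>K x) \<in> borel_measurable ?X"
      using measurable_prob_algebraD[OF Km] integral_measurable_subprob_algebra[OF vm]
      by (rule measurable_compose)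
    fix x assume x: "x \<in> space ?X"
    have Kx: "K x \<in> space (prob_algebra (states M))" using Km x by (rule measurable_space)
    then interpret Kx: prob_space "K x" by (simp add: space_prob_algebra)
    have sets: "sets (K x) = sets (states M)" using Kx by (simp add: space_prob_algebra)
    have sp: "space (K x) = space (states M)" using sets by (rule sets_eq_imp_space_eq)
    have vK: "v \<in> borel_measurable (K x)" using vm sets by (simp cong: measurable_cong_sets)
    have int: "integrable (K x) v"
      using vK v01 sp by (intro Kx.integrable_const_bound[where B=L]) auto
    show "0 \<le> (\<integral>s. v s \<partial>K x) \<and> (\<integral>s. v s \<partial>K x) \<le> L"
      using v01 sp by (auto intro!: integral_nonneg_AE Kx.integral_le_const int)
    have "next_mean M \<pi> K (action_value M \<pi> Q) x
        = (\<integral>\<^sup>+s. (\<integral>\<^sup>+a. action_value M \<pi> Q (s, a) \<partial>\<pi> s) \<partial>K x)"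
      unfolding next_mean_def by (rule nn_integral_choose_action[OF Q.policy Kx]) measurable
    also have "\<dots> = (\<integral>\<^sup>+s. ennreal (v s) \<partial>K x)"
      using Q.state_value_eq(1) sp by (intro nn_integral_cong) (simp add: v_def)
    also have "\<dots> = ennreal (\<integral>s. v s \<partial>K x)"
      using v01 sp by (intro nn_integral_eq_integral int) auto
    finally show "next_mean M \<pi> K (action_value M \<pi> Q) x = ennreal (\<integral>s. v s \<partial>K x)" .
  qed
  note mP = means[OF P.kernel, folded bP_def] and mQ = means[OF Q.kernel, folded bQ_def]
  have [measurable]: "bP \<in> borel_measurable ?X" "bQ \<in> borel_measurable ?X"
    using mP(1) mQ(1) by simp_all
  show "b \<in> borel_measurable ?X" unfolding b by measurable
  show b_le: "\<bar>b x\<bar> \<le> Rmax / (1 - ?\<gamma>)" if "x \<in> space ?X" for x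
  proof -
    have "\<bar>bP x - bQ x\<bar> \<le> L" using mP(2)[OF that] mQ(2)[OF that] by linarith
    then show ?thesis by (simp add: b L_def)
  qed
  have wm[measurable]: "w \<in> borel_measurable ?X" unfolding w_def by measurable
  have L0: "0 \<le> L" using P.Rmax_nonneg P.discount by (simp add: L_def)
  have w: "action_value M \<pi> Q x = ennreal (w x)" "0 \<le> w x \<and> w x \<le> L" if x: "x \<in> space ?X" for x
  proof -
    have le: "action_value M \<pi> Q x \<le> ennreal L" using Q.action_value_le[OF x] by (simp add: L_def)
    then show eq: "action_value M \<pi> Q x = ennreal (w x)"
      unfolding w_def by (intro ennreal_enn2real[symmetric]) (auto intro: le_less_trans)
    show "0 \<le> w x \<and> w x \<le> L"
      using le L0 unfolding eq by (simp add: w_def)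
  qed
  have Bellman: "reward M x = w x - ?\<gamma> * bQ x" if x: "x \<in> space ?X" for x
  proof -
    have "ennreal (w x) = ennreal (reward M x) + ennreal ?\<gamma> * ennreal (bQ x)"
      using Q.Bellman_equation[OF x] w(1)[OF x] mQ(3)[OF x] by simp
    also have "\<dots> = ennreal (reward M x + ?\<gamma> * bQ x)"
      using mQ(2)[OF x] Q.reward_bounds[OF x] Q.discount by (simp add: ennreal_mult ennreal_plus)
    finally have "w x = reward M x + ?\<gamma> * bQ x"
      using mQ(2)[OF x] Q.reward_bounds[OF x] Q.discount w(2)[OF x]
      by (subst (asm) ennreal_inj) auto
    then show ?thesis by simp
  qed
  \<comment> \<open>\<open>a t\<close> mixes the two kernels: the action value refers to
    \<open>Q\<close>, the law of the pair at time \<open>t\<close> to the true kernel.\<close>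
  define a where "a t = (\<integral>\<omega>. w (\<omega> t) \<partial>?T)" for t
  have int: "integrable ?T (\<lambda>\<omega>. w (\<omega> t))" "integrable ?T (\<lambda>\<omega>. bP (\<omega> t))" "integrable ?T (\<lambda>\<omega>. bQ (\<omega> t))" for t
    using w(2) mP(2) mQ(2) by (auto intro!: P.integrable_trajectory[where c=L])
  have nn: "(\<integral>\<^sup>+\<omega>. action_value M \<pi> Q (\<omega> t) \<partial>?T) = ennreal (a t)" for t
  proof -
    have "(\<integral>\<^sup>+\<omega>. action_value M \<pi> Q (\<omega> t) \<partial>?T) = (\<integral>\<^sup>+\<omega>. ennreal (w (\<omega> t)) \<partial>?T)"
      using w(1) P.space_coordinate by (intro nn_integral_cong) simp
    also have "\<dots> = ennreal (a t)"
      unfolding a_def using w(2) by (intro P.nn_integral_trajectory_real[where c=L]) auto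
    finally show ?thesis .
  qed
  have a0: "0 \<le> a t" for t
    unfolding a_def using w(2) P.space_coordinate by (intro integral_nonneg_AE AE_I2) blast
  have aL: "a t \<le> L" for t
    unfolding a_def using w(2) P.space_coordinate by (intro P.traj.integral_le_const int AE_I2) blast
  have a_Suc: "a (Suc t) = (\<integral>\<omega>. bP (\<omega> t) \<partial>?T)" for t
  proof -
    have "ennreal (a (Suc t)) = (\<integral>\<^sup>+\<omega>. next_mean M \<pi> (transition M) (action_value M \<pi> Q) (\<omega> t) \<partial>?T)"
      unfolding nn[symmetric] by (rule P.nn_integral_trajectory_Suc) measurable
    also have "\<dots> = (\<integral>\<^sup>+\<omega>. ennreal (bP (\<omega> t)) \<partial>?T)"
      using mP(3) P.space_coordinate by (intro nn_integral_cong) simp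
    also have "\<dots> = ennreal (\<integral>\<omega>. bP (\<omega> t) \<partial>?T)"
      using mP(2) by (intro P.nn_integral_trajectory_real[where c=L]) auto
    finally show ?thesis
      using a0 mP(2) P.space_coordinate by (subst (asm) ennreal_inj) (auto intro!: integral_nonneg_AE)
  qed
  \<comment> \<open>The first pair has the same law under both kernels, since it depends only on the
    initial law and the policy.\<close>
  have VQ: "policy_value M \<pi> Q = a 0"
  proof -
    have "ennreal (policy_value M \<pi> Q) = ennreal (a 0)"
      unfolding Q.ennreal_policy_value_initial nn[symmetric]
      using P.nn_integral_trajectory[OF Q.measurable_action_value, of 0] by simp
    moreover have "0 \<le> policy_value M \<pi> Q"
      using Q.policy_value_sums Q.reward_bounds Q.space_coordinate Q.discount
      by (rule_tac sums_le[OF _ sums_zero]) (auto intro!: mult_nonneg_nonneg integral_nonneg_AE)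
    ultimately show ?thesis using a0 by (simp add: ennreal_inj)
  qed
  \<comment> \<open>By \<open>Bellman\<close> the expected reward is \<open>a t\<close> minus
    \<gamma> times the mean of \<open>bQ\<close>. The \<open>a t\<close> terms cancel, and
    \<open>a_Suc\<close> turns the remaining one into the mean of \<open>bP\<close>.\<close>
  have reward: "?\<gamma> ^ t * (\<integral>\<omega>. reward M (\<omega> t) \<partial>?T) - (?\<gamma> ^ t * a t - ?\<gamma> ^ Suc t * a (Suc t))
      = ?\<gamma> * (?\<gamma> ^ t * (\<integral>\<omega>. b (\<omega> t) \<partial>?T))" for t
  proof -
    have "(\<integral>\<omega>. reward M (\<omega> t) \<partial>?T) = (\<integral>\<omega>. w (\<omega> t) - ?\<gamma> * bQ (\<omega> t) \<partial>?T)"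
      using Bellman P.space_coordinate by (intro Bochner_Integration.integral_cong) auto
    also have "\<dots> = a t - ?\<gamma> * (\<integral>\<omega>. bQ (\<omega> t) \<partial>?T)"
      using int by (simp add: a_def)
    finally have r: "(\<integral>\<omega>. reward M (\<omega> t) \<partial>?T) = a t - ?\<gamma> * (\<integral>\<omega>. bQ (\<omega> t) \<partial>?T)" .
    show ?thesis
      unfolding r a_Suc b using int by (simp add: algebra_simps)
  qed
  \<comment> \<open>The boundary term of the telescoping sum vanishes because \<open>a\<close> is
    bounded by \<open>L\<close>; what remains is \<open>a 0\<close>, the value under
    \<open>Q\<close>.\<close>
  have "(\<lambda>t. ?\<gamma> ^ t * a t) \<longlonglongrightarrow> 0"
  proof (rule tendsto_sandwich)
    show "\<forall>\<^sub>F t in sequentially. 0 \<le> ?\<gamma> ^ t * a t" using a0 P.discount by simp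
    show "\<forall>\<^sub>F t in sequentially. ?\<gamma> ^ t * a t \<le> ?\<gamma> ^ t * L"
      using aL P.discount by (auto intro!: mult_left_mono)
    show "(\<lambda>t. ?\<gamma> ^ t * L) \<longlonglongrightarrow> 0"
      using P.sums_geometric[of L] by (intro summable_LIMSEQ_zero) (auto simp: sums_iff)
  qed simp
  then have "(\<lambda>t. ?\<gamma> ^ t * a t - ?\<gamma> ^ Suc t * a (Suc t)) sums (?\<gamma> ^ 0 * a 0 - 0)"
    by (rule telescope_sums')
  from sums_diff[OF P.policy_value_sums this]
  show "(\<lambda>t. ?\<gamma> * (?\<gamma> ^ t * (\<integral>\<omega>. b (\<omega> t) \<partial>?T)))
      sums (policy_value M \<pi> (transition M) - policy_value M \<pi> Q)"
    unfolding reward by (simp add: VQ)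
qed

text \<open>The pointwise integrand \<open>l\<close> is abstract so that divergence and negative
  log-likelihood are treated at once. In the constant, the square of the leading discount and the
  occupancy mass give \<open>\<gamma>\<^sup>2 / (1 - \<gamma>)\<close>, and the range of the state
  value gives \<open>Rmax\<^sup>2 / (1 - \<gamma>)\<^sup>2 / 2\<close>.\<close>

lemma value_gap_le_occupancy:
  fixes M :: "('s, 'a) mdp"
  assumes P: "discounted_process M \<pi> (transition M) Rmax" and Q: "discounted_process M \<pi> Q Rmax"
    and loss: "\<And>x f. x \<in> space (state_actions M) \<Longrightarrow> f \<in> borel_measurable (states M) \<Longrightarrow>
      (\<And>s. s \<in> space (states M) \<Longrightarrow> f s \<in> {0..Rmax / (1 - discount M)}) \<Longrightarrow>
      ennreal (((\<integral>s. f s \<partial>transition M x) - (\<integral>s. f s \<partial>Q x))\<^sup>2)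
        \<le> ennreal ((Rmax / (1 - discount M))\<^sup>2 / 2) * l x"
  shows "ennreal ((value_gap M \<pi> Q)\<^sup>2)
    \<le> ennreal ((discount M)\<^sup>2 * Rmax\<^sup>2 / (1 - discount M) ^ 3 / 2) * (\<integral>\<^sup>+x. l x \<partial>occupancy M \<pi>)"
proof -
  interpret P: discounted_process M \<pi> "transition M" Rmax by fact
  interpret Q: discounted_process M \<pi> Q Rmax by fact
  let ?X = "state_actions M" and ?T = "trajectory M (transition M) \<pi>" and ?\<gamma> = "discount M"
    and ?O = "occupancy M \<pi>"
  define L where "L = Rmax / (1 - ?\<gamma>)"
  define b where "b x = (\<integral>s. state_value M \<pi> Q s \<partial>transition M x) - (\<integral>s. state_value M \<pi> Q s \<partial>Q x)" for x
  note sim = simulation_lemma[OF P Q, folded b_def L_def]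
  have [measurable]: "b \<in> borel_measurable ?X" by (rule sim(2))
  have setsO: "sets ?O = sets ?X" by (simp add: occupancy_def sets.sigma_sets_eq sets.space_closed)
  have spO: "space ?O = space ?X" using setsO by (rule sets_eq_imp_space_eq)
  have bO: "b \<in> borel_measurable ?O" using sim(2) setsO by (simp cong: measurable_cong_sets)
  have mass: "emeasure ?O (space ?O) = ennreal (1 / (1 - ?\<gamma>))"
    using nn_integral_occupancy[OF P, of "\<lambda>_. 1"] P.suminf_geometric[of 1]
    by (simp add: P.traj.emeasure_space_1)
  interpret O: finite_measure ?O
    using mass by (intro finite_measureI) simp
  have mass': "measure ?O (space ?O) = 1 / (1 - ?\<gamma>)"
    using mass P.discount by (simp add: measure_def)
  have absb: "\<bar>b x\<bar> \<le> L" if "x \<in> space ?X" for x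
    using sim(3)[OF that] .
  have int: "integrable ?O (\<lambda>x. \<bar>b x\<bar>)" "integrable ?O (\<lambda>x. (b x)\<^sup>2)"
  proof -
    have "(b x)\<^sup>2 \<le> L\<^sup>2" if "x \<in> space ?X" for x
      using absb[OF that] by (intro power2_le_iff_abs_le[THEN iffD2]) auto
    then have "AE x in ?O. norm ((b x)\<^sup>2) \<le> L\<^sup>2" using spO by (intro AE_I2) simp
    then show "integrable ?O (\<lambda>x. (b x)\<^sup>2)"
      using bO by (intro O.integrable_const_bound[where B="L\<^sup>2"]) auto
    have "AE x in ?O. norm \<bar>b x\<bar> \<le> L" using absb spO by (intro AE_I2) simp
    then show "integrable ?O (\<lambda>x. \<bar>b x\<bar>)"
      using bO by (intro O.integrable_const_bound[where B=L]) auto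
  qed
  have gap: "value_gap M \<pi> Q \<le> ?\<gamma> * (\<integral>x. \<bar>b x\<bar> \<partial>?O)"
  proof -
    let ?c = "\<lambda>t. \<integral>\<omega>. \<bar>b (\<omega> t)\<bar> \<partial>?T"
    have c: "0 \<le> ?c t" for t by simp
    have nn: "ennreal (\<integral>x. \<bar>b x\<bar> \<partial>?O) = (\<Sum>t. ennreal (?\<gamma> ^ t * ?c t))"
    proof -
      have "ennreal (\<integral>x. \<bar>b x\<bar> \<partial>?O) = (\<integral>\<^sup>+x. ennreal \<bar>b x\<bar> \<partial>?O)"
        using int by (intro nn_integral_eq_integral[symmetric]) auto
      also have "\<dots> = (\<Sum>t. ennreal (?\<gamma> ^ t) * (\<integral>\<^sup>+\<omega>. ennreal \<bar>b (\<omega> t)\<bar> \<partial>?T))"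
        by (rule nn_integral_occupancy[OF P]) measurable
      also have "\<dots> = (\<Sum>t. ennreal (?\<gamma> ^ t) * ennreal (?c t))"
        using absb by (intro suminf_cong arg_cong[where f="(*) _"] P.nn_integral_trajectory_real[where c=L]) auto
      also have "\<dots> = (\<Sum>t. ennreal (?\<gamma> ^ t * ?c t))"
        using P.discount by (intro suminf_cong ennreal_mult[symmetric] c) auto
      finally show ?thesis .
    qed
    have nonneg: "0 \<le> ?\<gamma> ^ t * ?c t" for t using c P.discount by simp
    \<comment> \<open>The \<open>ennreal\<close> series equals a finite integral, which is what
      makes the real series converge.\<close>
    have summ: "summable (\<lambda>t. ?\<gamma> ^ t * ?c t)"
      using nn nonneg by (intro summable_suminf_not_top) auto
    have "(\<Sum>t. ?\<gamma> ^ t * ?c t) = (\<integral>x. \<bar>b x\<bar> \<partial>?O)"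
      using nn suminf_ennreal2[OF nonneg summ] suminf_nonneg[OF summ nonneg] by simp
    then have sums: "(\<lambda>t. ?\<gamma> * (?\<gamma> ^ t * ?c t)) sums (?\<gamma> * (\<integral>x. \<bar>b x\<bar> \<partial>?O))"
      using summ by (intro sums_mult) (simp add: sums_iff)
    have le: "\<bar>?\<gamma> * (?\<gamma> ^ t * (\<integral>\<omega>. b (\<omega> t) \<partial>?T))\<bar> \<le> ?\<gamma> * (?\<gamma> ^ t * ?c t)" for t
      using P.discount by (simp add: abs_mult mult_left_mono)
    have "policy_value M \<pi> (transition M) - policy_value M \<pi> Q \<le> ?\<gamma> * (\<integral>x. \<bar>b x\<bar> \<partial>?O)"
      using le by (intro sums_le[OF _ sim(1) sums]) (simp add: abs_le_iff)
    moreover have "- (policy_value M \<pi> (transition M) - policy_value M \<pi> Q) \<le> ?\<gamma> * (\<integral>x. \<bar>b x\<bar> \<partial>?O)"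
      using le by (intro sums_le[OF _ sums_minus[OF sim(1)] sums]) (simp add: abs_le_iff)
    ultimately show ?thesis by (simp add: value_gap_def)
  qed
  have "(value_gap M \<pi> Q)\<^sup>2 \<le> (?\<gamma> * (\<integral>x. \<bar>b x\<bar> \<partial>?O))\<^sup>2"
    using gap by (intro power_mono) (auto simp: value_gap_def)
  also have "\<dots> \<le> ?\<gamma>\<^sup>2 * (1 / (1 - ?\<gamma>) * (\<integral>x. (b x)\<^sup>2 \<partial>?O))"
    using O.square_integral_le[of "\<lambda>x. \<bar>b x\<bar>" L] bO absb spO
    unfolding mass' power_mult_distrib by (intro mult_left_mono) auto
  finally have "ennreal ((value_gap M \<pi> Q)\<^sup>2) \<le> ennreal (?\<gamma>\<^sup>2 / (1 - ?\<gamma>) * (\<integral>x. (b x)\<^sup>2 \<partial>?O))"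
    by (intro ennreal_leI) simp
  also have "\<dots> = ennreal (?\<gamma>\<^sup>2 / (1 - ?\<gamma>)) * (\<integral>\<^sup>+x. ennreal ((b x)\<^sup>2) \<partial>?O)"
    using P.discount int(2) by (subst ennreal_mult) (auto simp: nn_integral_eq_integral)
  also have "\<dots> \<le> ennreal (?\<gamma>\<^sup>2 / (1 - ?\<gamma>)) * (ennreal (L\<^sup>2 / 2) * (\<integral>\<^sup>+x. l x \<partial>?O))"
  proof (rule mult_left_mono)
    have ptw: "ennreal ((b x)\<^sup>2) \<le> ennreal (L\<^sup>2 / 2) * l x" if "x \<in> space ?X" for x
      unfolding b_def L_def using Q.state_value_eq(2) by (intro loss that) auto
    show "(\<integral>\<^sup>+x. ennreal ((b x)\<^sup>2) \<partial>?O) \<le> ennreal (L\<^sup>2 / 2) * (\<integral>\<^sup>+x. l x \<partial>?O)"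
    \<comment> \<open>The general argument divides by \<open>L\<^sup>2 / 2\<close>. For
      \<open>L = 0\<close> the bound on \<open>b\<close> makes the left side zero.\<close>
    proof (cases "L = 0")
      case True
      then have "(\<integral>\<^sup>+x. ennreal ((b x)\<^sup>2) \<partial>?O) = (\<integral>\<^sup>+x. 0 \<partial>?O)"
        using absb spO by (intro nn_integral_cong) simp
      then show ?thesis by simp
    next
      case False
      \<comment> \<open>\<open>l\<close> need not be measurable, so the constant is moved out of the integral of the left side.\<close>
      have "(\<integral>\<^sup>+x. ennreal ((b x)\<^sup>2) \<partial>?O) = (\<integral>\<^sup>+x. ennreal (L\<^sup>2 / 2) * ennreal ((b x)\<^sup>2 / (L\<^sup>2 / 2)) \<partial>?O)"
        using False by (intro nn_integral_cong) (simp add: ennreal_mult[symmetric])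
      also have "\<dots> = ennreal (L\<^sup>2 / 2) * (\<integral>\<^sup>+x. ennreal ((b x)\<^sup>2 / (L\<^sup>2 / 2)) \<partial>?O)"
        by (intro nn_integral_cmult measurable_compose[OF bO, of "\<lambda>y. ennreal (y\<^sup>2 / (L\<^sup>2 / 2))"])
          measurable
      also have "\<dots> \<le> ennreal (L\<^sup>2 / 2) * (\<integral>\<^sup>+x. l x \<partial>?O)"
      proof (intro mult_left_mono nn_integral_mono)
        fix x assume "x \<in> space ?O"
        then have "ennreal ((b x)\<^sup>2) \<le> ennreal (L\<^sup>2 / 2) * l x" using ptw spO by simp
        moreover have "ennreal ((b x)\<^sup>2 / (L\<^sup>2 / 2)) = ennreal ((b x)\<^sup>2) / ennreal (L\<^sup>2 / 2)"
          using False by (intro divide_ennreal[symmetric]) auto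
        moreover have "ennreal (L\<^sup>2 / 2) * l x / ennreal (L\<^sup>2 / 2) = l x"
          using False by (subst mult.commute, intro ennreal_mult_divide_eq) auto
        ultimately show "ennreal ((b x)\<^sup>2 / (L\<^sup>2 / 2)) \<le> l x"
          using divide_right_mono_ennreal[of _ _ "ennreal (L\<^sup>2 / 2)"] by metis
      qed simp
      finally show ?thesis .
    qed
  qed simp
  also have "\<dots> = ennreal (?\<gamma>\<^sup>2 * Rmax\<^sup>2 / (1 - ?\<gamma>) ^ 3 / 2) * (\<integral>\<^sup>+x. l x \<partial>?O)"
  proof -
    have "?\<gamma>\<^sup>2 / (1 - ?\<gamma>) * (L\<^sup>2 / 2) = ?\<gamma>\<^sup>2 * Rmax\<^sup>2 / (1 - ?\<gamma>) ^ 3 / 2"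
      by (simp add: L_def power_divide power2_eq_square power3_eq_cube)
    moreover have "ennreal (?\<gamma>\<^sup>2 / (1 - ?\<gamma>)) * ennreal (L\<^sup>2 / 2) = ennreal (?\<gamma>\<^sup>2 / (1 - ?\<gamma>) * (L\<^sup>2 / 2))"
      using P.discount by (intro ennreal_mult[symmetric]) auto
    ultimately show ?thesis by (metis mult.assoc)
  qed
  finally show ?thesis .
qed

section \<open>The regret bound\<close>

lemma gap_bound_ereal:
  assumes "0 \<le> x"
  shows "gap_bound M Rmax (ereal x)
    = ereal (discount M * Rmax / (1 - discount M) powr (3 / 2) * sqrt (x / 2))"
  using assms by (simp add: gap_bound_def ereal_sqrt_def)

text \<open>Subadditivity of the square root gives a modulus of continuity that is uniform in
  \<open>x\<close> and \<open>y\<close>. Hence a vanishing average regret suffices without any bound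
  on the average losses.\<close>

lemma abs_sqrt_diff_le:
  fixes x y :: real
  assumes "0 \<le> x" "0 \<le> y"
  shows "\<bar>sqrt x - sqrt y\<bar> \<le> sqrt \<bar>x - y\<bar>"
proof -
  have *: "sqrt u \<le> sqrt v + sqrt \<bar>u - v\<bar>" if "0 \<le> u" "0 \<le> v" for u v :: real
  proof -
    have "sqrt u \<le> sqrt (v + \<bar>u - v\<bar>)" by simp
    also have "\<dots> \<le> sqrt v + sqrt \<bar>u - v\<bar>" using that by (intro sqrt_add_le_add_sqrt) auto
    finally show ?thesis .
  qed
  show ?thesis using *[OF assms] *[OF assms(2,1)] by (simp add: abs_le_iff abs_minus_commute)
qed

text \<open>This connects the infimum of averages in \<open>best_average_loss\<close> with the
  infimum of sums in \<open>regret\<close>.\<close>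

lemma INF_sum_divide:
  fixes f :: "'k \<Rightarrow> ereal"
  assumes "1 \<le> T" "\<M> \<noteq> {}"
  shows "(INF K \<in> \<M>. f K / ereal (real T)) = (INF K \<in> \<M>. f K) / ereal (real T)"
proof (rule antisym)
  have T: "0 < ereal (real T)" "ereal (real T) \<noteq> \<infinity>" using assms by auto
  show "(INF K \<in> \<M>. f K) / ereal (real T) \<le> (INF K \<in> \<M>. f K / ereal (real T))"
    using T by (intro INF_greatest ereal_divide_right_mono INF_lower) auto
  have "ereal (real T) * (INF K \<in> \<M>. f K / ereal (real T)) \<le> f K" if "K \<in> \<M>" for K
    using T INF_lower[OF that, of "\<lambda>K. f K / ereal (real T)"]
    by (metis ereal_le_divide_pos)
  then show "(INF K \<in> \<M>. f K / ereal (real T)) \<le> (INF K \<in> \<M>. f K) / ereal (real T)"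
    using T by (subst ereal_le_divide_pos) (auto intro: INF_greatest)
qed

text \<open>The squared form is linear in the loss, so it can be summed over rounds in
  \<open>ereal\<close> before any root is taken, infinite losses included.\<close>

lemma value_gap_square_le_loss:
  assumes M: "discounted_mdp M Rmax"
    and reg: "finite_regular M \<M> \<and> loss = nll_loss M \<or> density_regular M \<M> \<and> loss = kl_loss M"
    and \<pi>: "\<pi> \<in> policies M" and Q: "Q \<in> \<M>"
  shows "ereal ((value_gap M \<pi> Q)\<^sup>2)
    \<le> ereal ((discount M * Rmax / (1 - discount M) powr (3 / 2))\<^sup>2 / 2) * loss \<pi> Q"
proof -
  have Qk: "Q \<in> transition_kernels M" and Pk: "transition M \<in> transition_kernels M"
    using M reg Q by (auto simp: finite_regular_def density_regular_def regular_class_def discounted_mdp_def)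
  have dp: "discounted_process M \<pi> K Rmax" if "K \<in> transition_kernels M" for K
    using M \<pi> that by unfold_locales (auto simp: discounted_mdp_def)
  have kern: "prob_space (K x)" "sets (K x) = sets (states M)"
    if "K \<in> transition_kernels M" "x \<in> space (state_actions M)" for K x
    using that measurable_space[of K "state_actions M" "prob_algebra (states M)" x]
    by (auto simp: transition_kernels_def space_prob_algebra)
  \<comment> \<open>Both losses are occupancy integrals of some \<open>l\<close>. The first
    alternative keeps finiteness, which the likelihood estimate needs; the estimate for
    \<open>KL\<close> holds on any space.\<close>
  obtain l where loss: "loss \<pi> Q = enn2ereal (\<integral>\<^sup>+x. l x \<partial>occupancy M \<pi>)"
    and l: "finite_regular M \<M> \<and> l = (\<lambda>x. \<integral>\<^sup>+s'. neg_log (measure (Q x) {s'}) \<partial>transition M x)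
      \<or> l = (\<lambda>x. KL (transition M x) (Q x))"
    using reg by (auto simp: nll_loss_def kl_loss_def)
  have "ennreal ((value_gap M \<pi> Q)\<^sup>2)
      \<le> ennreal ((discount M)\<^sup>2 * Rmax\<^sup>2 / (1 - discount M) ^ 3 / 2) * (\<integral>\<^sup>+x. l x \<partial>occupancy M \<pi>)"
  proof (rule value_gap_le_occupancy[OF dp[OF Pk] dp[OF Qk]])
    fix x f
    assume x: "x \<in> space (state_actions M)" and f: "f \<in> borel_measurable (states M)"
      and bnd: "\<And>s. s \<in> space (states M) \<Longrightarrow> f s \<in> {0..Rmax / (1 - discount M)}"
    note P' = kern[OF Pk x] and Q' = kern[OF Qk x]
    have sp: "space (transition M x) = space (states M)"
      using P'(2) by (rule sets_eq_imp_space_eq)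
    have fP: "f \<in> borel_measurable (transition M x)"
      using f P'(2) by (simp cong: measurable_cong_sets)
    have sets_eq: "sets (Q x) = sets (transition M x)" using P' Q' by simp
    have bnd': "f s \<in> {0..Rmax / (1 - discount M)}" if "s \<in> space (transition M x)" for s
      using bnd that sp by simp
    show "ennreal (((\<integral>s. f s \<partial>transition M x) - (\<integral>s. f s \<partial>Q x))\<^sup>2)
        \<le> ennreal ((Rmax / (1 - discount M))\<^sup>2 / 2) * l x"
      using l
    proof (elim disjE conjE)
      assume l: "l = (\<lambda>x. \<integral>\<^sup>+s'. neg_log (measure (Q x) {s'}) \<partial>transition M x)"
        and "finite_regular M \<M>"
      then have "finite (space (transition M x))" "sets (transition M x) = Pow (space (transition M x))"
        using sp P'(2) by (auto simp: finite_regular_def)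
      from mean_difference_square_le_nll[OF P'(1) Q'(1) sets_eq this fP bnd']
      show ?thesis by (simp add: l)
    next
      assume l: "l = (\<lambda>x. KL (transition M x) (Q x))"
      show ?thesis
        using mean_difference_square_le_KL[OF P'(1) Q'(1) sets_eq fP bnd'] by (simp add: l)
    qed
  qed
  moreover have "((1 - discount M) powr (3 / 2))\<^sup>2 = (1 - discount M) ^ 3"
    using M by (simp add: discounted_mdp_def powr_power)
  then have "(discount M * Rmax / (1 - discount M) powr (3 / 2))\<^sup>2 / 2
      = (discount M)\<^sup>2 * Rmax\<^sup>2 / (1 - discount M) ^ 3 / 2"
    by (simp add: power_divide power_mult_distrib)
  ultimately have "enn2ereal (ennreal ((value_gap M \<pi> Q)\<^sup>2))
      \<le> enn2ereal (ennreal ((discount M * Rmax / (1 - discount M) powr (3 / 2))\<^sup>2 / 2)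
          * (\<integral>\<^sup>+x. l x \<partial>occupancy M \<pi>))"
    by (simp add: less_eq_ennreal.rep_eq)
  then show ?thesis by (simp add: loss times_ennreal.rep_eq)
qed

theorem theorem3:
  fixes M :: "('s, 'a) mdp" and Rmax :: real
    and \<M> :: "('s \<times> 'a \<Rightarrow> 's measure) set"
    and loss :: "('s \<Rightarrow> 'a measure) \<Rightarrow> ('s \<times> 'a \<Rightarrow> 's measure) \<Rightarrow> ereal"
    and \<pi> :: "nat \<Rightarrow> 's \<Rightarrow> 'a measure"
    and Q :: "nat \<Rightarrow> 's \<times> 'a \<Rightarrow> 's measure"
  assumes "discounted_mdp M Rmax"
    and "finite_regular M \<M> \<and> loss = nll_loss M \<or> density_regular M \<M> \<and> loss = kl_loss M"
    and "\<And>t. 1 \<le> t \<Longrightarrow> \<pi> t \<in> policies M"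
    and "\<And>t. 1 \<le> t \<Longrightarrow> Q t \<in> \<M>"
  shows "(\<forall>T \<ge> 1. ereal (average_gap M \<pi> Q T)
            \<le> gap_bound M Rmax
                (best_average_loss loss \<M> \<pi> T + regret loss \<M> \<pi> Q T / ereal (real T)))
    \<and> ((\<forall>\<^sub>F T in sequentially. \<bar>regret loss \<M> \<pi> Q T\<bar> \<noteq> \<infinity>) \<and>
        (\<lambda>T. real_of_ereal (regret loss \<M> \<pi> Q T)) \<in> o(\<lambda>T. real T)
       \<longrightarrow> ((\<lambda>T. gap_bound M Rmax
                (best_average_loss loss \<M> \<pi> T + regret loss \<M> \<pi> Q T / ereal (real T))
              - gap_bound M Rmax (best_average_loss loss \<M> \<pi> T)) \<longlonglongrightarrow> 0)
         \<and> limsup (\<lambda>T. ereal (average_gap M \<pi> Q T)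
              - gap_bound M Rmax (best_average_loss loss \<M> \<pi> T)) \<le> 0)"
proof -
  define C where "C = discount M * Rmax / (1 - discount M) powr (3 / 2)"
  define S where "S T = (\<Sum>t = 1..T. loss (\<pi> t) (Q t))" for T
  define I where "I T = (INF K \<in> \<M>. \<Sum>t = 1..T. loss (\<pi> t) K)" for T
  define reg where "reg T = regret loss \<M> \<pi> Q T" for T
  define best where "best T = best_average_loss loss \<M> \<pi> T" for T
  have loss0: "0 \<le> loss p K" for p K
    using assms(2) by (auto simp: nll_loss_def kl_loss_def)
  have ne: "\<M> \<noteq> {}" using assms(4)[of 1] by auto
  have S0: "0 \<le> S T" for T unfolding S_def by (intro sum_nonneg loss0)
  have I0: "0 \<le> I T" for T unfolding I_def by (intro INF_greatest sum_nonneg loss0)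
  have reg: "reg T = S T - I T" for T by (simp add: reg_def regret_def S_def I_def)
  have best: "best T = I T / ereal (real T)" if "1 \<le> T" for T
    unfolding best_def best_average_loss_def I_def by (rule INF_sum_divide[OF that ne])
  \<comment> \<open>The policy of round 1 provides a process, from which nonnegativity of
    \<open>Rmax\<close>, and so of \<open>C\<close>, follows.\<close>
  have process: "discounted_process M (\<pi> 1) (transition M) Rmax"
    using assms(1,3) by unfold_locales (auto simp: discounted_mdp_def)
  then have C0: "0 \<le> C"
    using discounted_process.Rmax_nonneg[OF process] discounted_process.discount[OF process]
    by (simp add: C_def)

  have gap_le: "average_gap M \<pi> Q T \<le> C * sqrt (s / real T / 2)"
    if T: "1 \<le> T" and s: "S T = ereal s" for T s
  proof -
    define g where "g t = value_gap M (\<pi> t) (Q t)" for t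
    have s0: "0 \<le> s" using S0[of T] s by simp
    have "ereal (\<Sum>t = 1..T. (g t)\<^sup>2) = (\<Sum>t = 1..T. ereal ((g t)\<^sup>2))" by simp
    also have "\<dots> \<le> (\<Sum>t = 1..T. ereal (C\<^sup>2 / 2) * loss (\<pi> t) (Q t))"
      unfolding g_def C_def
      by (intro sum_mono value_gap_square_le_loss[OF assms(1,2)] assms(3,4)) auto
    also have "\<dots> = ereal (C\<^sup>2 / 2) * S T"
      unfolding S_def using loss0 by (intro sum_ereal_right_distrib[symmetric])
    finally have sq: "(\<Sum>t = 1..T. (g t)\<^sup>2) \<le> C\<^sup>2 / 2 * s" by (simp add: s)
    \<comment> \<open>Cauchy--Schwarz over the rounds costs a factor \<open>T\<close>; dividing by
      \<open>T\<^sup>2\<close> leaves the average loss \<open>s / real T\<close> under the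
      root.\<close>
    have "(\<Sum>t = 1..T. g t)\<^sup>2 \<le> (\<Sum>t = 1..T. (g t)\<^sup>2) * real T"
      using sum_squared_le_sum_of_squares[of g "{1..T}"] by simp
    also have "\<dots> \<le> C\<^sup>2 / 2 * s * real T" using sq by (intro mult_right_mono) auto
    finally have "((\<Sum>t = 1..T. g t) / real T)\<^sup>2 \<le> (C * sqrt (s / real T / 2))\<^sup>2"
      using T s0 by (simp add: power_divide power_mult_distrib field_simps power2_eq_square)
    then have "(\<Sum>t = 1..T. g t) / real T \<le> C * sqrt (s / real T / 2)"
      using C0 s0 by (rule_tac power2_le_imp_le) auto
    then show ?thesis by (simp add: average_gap_def g_def)
  qed

  have sum_eq: "best T + reg T / ereal (real T) = S T / ereal (real T)"
    if T: "1 \<le> T" and fin: "S T \<noteq> \<infinity>" "I T \<noteq> \<infinity>" for T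
  proof -
    obtain s i where "S T = ereal s" "I T = ereal i"
      using fin S0[of T] I0[of T] by (cases "S T"; cases "I T") auto
    then show ?thesis using T by (simp add: reg best field_simps)
  qed
  \<comment> \<open>An infinite comparator with finite player loss makes the regret
    \<open>- \<infinity>\<close>. The sum is still infinite, because
    \<open>\<infinity> + - \<infinity> = \<infinity>\<close> in \<open>ereal\<close>.\<close>
  have sum_PInf: "best T + reg T / ereal (real T) = \<infinity>"
    if "1 \<le> T" "S T = \<infinity> \<or> I T = \<infinity>" for T
    using that S0[of T] I0[of T] by (cases "S T"; cases "I T") (auto simp: reg best)

  have bound: "ereal (average_gap M \<pi> Q T) \<le> gap_bound M Rmax (best T + reg T / ereal (real T))"
    if T: "1 \<le> T" for T
  proof (cases "S T = \<infinity> \<or> I T = \<infinity>")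
    case True
    show ?thesis
    proof (cases "C = 0")
      case False
      then have "gap_bound M Rmax \<infinity> = \<infinity>"
        using C0 by (simp add: gap_bound_def ereal_sqrt_def C_def[symmetric])
      then show ?thesis unfolding sum_PInf[OF T True] by simp
    next
      \<comment> \<open>Here the right-hand side is \<open>0 * \<infinity> = 0\<close>, so the gaps
        must vanish; the squared bound with constant 0 yields this.\<close>
      case C: True
      have "value_gap M (\<pi> t) (Q t) = 0" if "1 \<le> t" for t
        using value_gap_square_le_loss[OF assms(1,2) assms(3,4)[OF that]]
        by (simp add: C_def[symmetric] C zero_ereal_def[symmetric])
      then have "average_gap M \<pi> Q T = 0" by (simp add: average_gap_def)
      then show ?thesis
        unfolding sum_PInf[OF T True] by (simp add: gap_bound_def C_def[symmetric] C flip: zero_ereal_def)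
    qed
  next
    case False
    then obtain s where s: "S T = ereal s" using S0[of T] by (cases "S T") auto
    have "0 \<le> s / real T" using S0[of T] s by simp
    then have "gap_bound M Rmax (S T / ereal (real T)) = ereal (C * sqrt (s / real T / 2))"
      using T s gap_bound_ereal[of "s / real T" M Rmax] by (simp add: C_def)
    then show ?thesis using gap_le[OF T s] sum_eq[OF T] False by simp
  qed

  have "((\<lambda>T. gap_bound M Rmax (best T + reg T / ereal (real T)) - gap_bound M Rmax (best T)) \<longlonglongrightarrow> 0)
      \<and> limsup (\<lambda>T. ereal (average_gap M \<pi> Q T) - gap_bound M Rmax (best T)) \<le> 0"
    if fin: "\<forall>\<^sub>F T in sequentially. \<bar>reg T\<bar> \<noteq> \<infinity>" and small: "(\<lambda>T. real_of_ereal (reg T)) \<in> o(\<lambda>T. real T)"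
  proof -
    define d where "d T = gap_bound M Rmax (best T + reg T / ereal (real T)) - gap_bound M Rmax (best T)" for T
    \<comment> \<open>\<open>e\<close> is the envelope that the square-root modulus gives for the
      difference of the two bounds. It depends on the average regret alone.\<close>
    define e where "e T = C * sqrt (\<bar>real_of_ereal (reg T) / real T\<bar> / 2)" for T
    have "(\<lambda>T. real_of_ereal (reg T) / real T) \<longlonglongrightarrow> 0"
      using small by (rule smalloD_tendsto)
    then have "(\<lambda>T. sqrt (\<bar>real_of_ereal (reg T) / real T\<bar> / 2)) \<longlonglongrightarrow> sqrt (\<bar>0\<bar> / 2)"
      by (intro tendsto_intros) auto
    from tendsto_mult_left[OF this, of C] have e_lim: "e \<longlonglongrightarrow> 0"
      by (simp add: e_def[abs_def])
    have ev: "\<forall>\<^sub>F T in sequentially. ereal (- e T) \<le> d T \<and> d T \<le> ereal (e T)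
        \<and> ereal (average_gap M \<pi> Q T) - gap_bound M Rmax (best T) \<le> d T"
      using fin eventually_ge_at_top[of 1]
    proof eventually_elim
      case (elim T)
      \<comment> \<open>Finite regret forces both nonnegative terms to be finite: one infinite term
        gives an infinite difference, and
        \<open>\<infinity> - \<infinity> = \<infinity>\<close>.\<close>
      then have nI: "S T \<noteq> \<infinity>" "I T \<noteq> \<infinity>"
        using S0[of T] I0[of T] by (cases "S T"; cases "I T"; simp add: reg)+
      then obtain s i where si: "S T = ereal s" "I T = ereal i"
        using S0[of T] I0[of T] nI by (cases "S T"; cases "I T") auto
      let ?s = "s / real T" and ?i = "i / real T"
      have nn: "0 \<le> ?s" "0 \<le> ?i" using S0[of T] I0[of T] si by auto
      have 1: "gap_bound M Rmax (best T + reg T / ereal (real T)) = ereal (C * sqrt (?s / 2))"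
        using sum_eq[OF elim(2) nI] gap_bound_ereal[OF nn(1), of M Rmax] si elim(2) by (simp add: C_def)
      have 2: "gap_bound M Rmax (best T) = ereal (C * sqrt (?i / 2))"
        using best[OF elim(2)] gap_bound_ereal[OF nn(2), of M Rmax] si elim(2) by (simp add: C_def)
      have "\<bar>C * sqrt (?s / 2) - C * sqrt (?i / 2)\<bar> = C * \<bar>sqrt (?s / 2) - sqrt (?i / 2)\<bar>"
        using C0 by (simp add: abs_mult right_diff_distrib[symmetric])
      also have "\<dots> \<le> C * sqrt \<bar>?s / 2 - ?i / 2\<bar>"
        using C0 nn by (intro mult_left_mono abs_sqrt_diff_le) auto
      also have "\<bar>?s / 2 - ?i / 2\<bar> = \<bar>real_of_ereal (reg T) / real T\<bar> / 2"
        by (simp add: reg si diff_divide_distrib[symmetric] abs_divide)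
      finally have "\<bar>C * sqrt (?s / 2) - C * sqrt (?i / 2)\<bar> \<le> e T" by (simp add: e_def)
      moreover have "ereal (average_gap M \<pi> Q T) \<le> ereal (C * sqrt (?s / 2))"
        using bound[OF elim(2)] 1 by simp
      ultimately show ?case by (simp add: d_def 1 2 abs_le_iff)
    qed
    have d_lim: "d \<longlonglongrightarrow> 0"
    proof (rule tendsto_sandwich)
      show "\<forall>\<^sub>F T in sequentially. ereal (- e T) \<le> d T"
        using ev by (rule eventually_mono) simp
      show "\<forall>\<^sub>F T in sequentially. d T \<le> ereal (e T)"
        using ev by (rule eventually_mono) simp
      show "(\<lambda>T. ereal (- e T)) \<longlonglongrightarrow> 0" "(\<lambda>T. ereal (e T)) \<longlonglongrightarrow> 0"
        using tendsto_minus[OF e_lim] e_lim by (simp_all add: zero_ereal_def)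
    qed
    \<comment> \<open>The estimate of the average gap is one-sided, so the limit of \<open>d\<close>
      passes to it only as an upper bound on the limsup.\<close>
    moreover have "limsup (\<lambda>T. ereal (average_gap M \<pi> Q T) - gap_bound M Rmax (best T)) \<le> limsup d"
      using ev by (intro Limsup_mono) (auto elim: eventually_mono)
    ultimately show ?thesis
      using lim_imp_Limsup[OF _ d_lim] by (auto simp: d_def[abs_def])
  qed
  then show ?thesis using bound by (auto simp: reg_def best_def)
qed

end
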